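(* There is an algorithm that, given a graph $G$ on $n$ vertices and an edge $xy\in E_G$, decides in time $O(n^4)$ whether there exists a graph $H$ with girth at least six such that $H^2=G$ and $xy\in E_H$ (and outputs such an $H$ if one exists).
   Context: All graphs are finite, undirected and simple. For a graph $H$, $H^2$ is the graph on the same vertex set in which two distinct vertices are adjacent iff their distance in $H$ is at most $2$. The girth of a graph is the length of a shortest cycle ($\infty$ if acyclic). *)

theory Defs
  imports Complex_Main "HOL-Library.Extended_Nat" "HOL-Library.Landau_Symbols"
begin

section \<open>Graphs\<close>

record 'a ugraph =
  verts :: "'a set"
  edges :: "'a set set"

definition simple_graph :: "'a ugraph \<Rightarrow> bool" where
  "simple_graph G \<longleftrightarrow> finite (verts G) \<and> (\<forall>e\<in>edges G. e \<subseteq> verts G \<and> card e = 2)"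

text \<open>A walk is its nonempty list of vertices; its length is the number of edges traversed.\<close>

definition walk :: "'a ugraph \<Rightarrow> 'a list \<Rightarrow> bool" where
  "walk G p \<longleftrightarrow> p \<noteq> [] \<and> set p \<subseteq> verts G
     \<and> (\<forall>i. Suc i < length p \<longrightarrow> {p ! i, p ! Suc i} \<in> edges G)"

definition walk_length :: "'a list \<Rightarrow> nat" where
  "walk_length p = length p - 1"

text \<open>The infimum of the empty set in \<^typ>\<open>enat\<close> is infinity, so vertices in different components have
  distance infinity, and acyclic graphs have girth infinity.\<close>

definition distance :: "'a ugraph \<Rightarrow> 'a \<Rightarrow> 'a \<Rightarrow> enat" where
  "distance G u v = (INF p \<in> {p. walk G p \<and> hd p = u \<and> last p = v}. enat (walk_length p))"

text \<open>The start vertex of a cycle occurs at both ends of the list. The bound 3 rules out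
  traversing one edge back and forth.\<close>

definition cycle :: "'a ugraph \<Rightarrow> 'a list \<Rightarrow> bool" where
  "cycle G p \<longleftrightarrow> walk G p \<and> hd p = last p \<and> distinct (tl p) \<and> walk_length p \<ge> 3"

definition girth :: "'a ugraph \<Rightarrow> enat" where
  "girth G = (INF p \<in> {p. cycle G p}. enat (walk_length p))"

definition square :: "'a ugraph \<Rightarrow> 'a ugraph" where
  "square H = \<lparr> verts = verts H,
     edges = {{u, v} | u v. u \<in> verts H \<and> v \<in> verts H \<and> u \<noteq> v \<and> distance H u v \<le> 2} \<rparr>"


section \<open>Algorithms and running time\<close>

text \<open>
  Algorithms are programs for a word RAM with unit-cost operations, written with structured control
  flow. The memory consists of named arrays of words; a scalar variable is cell 0 of its array. A
  program is a finite object and therefore uses only constantly many arrays, so they could be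
  interleaved in one linear memory with constant overhead.
\<close>

type_synonym vname = string
type_synonym state = "vname \<Rightarrow> nat \<Rightarrow> nat"

datatype binop = Add | Sub | Mul | Less | Equal

datatype expr =
    Const nat
  | Read vname expr
  | Bin binop expr expr

datatype com =
    Skip
  | Write vname expr expr
  | Seq com com
  | If expr com com
  | While expr com

text \<open>Subtraction is truncated at 0; comparisons return 1 for true and 0 for false.\<close>

fun binop_val :: "binop \<Rightarrow> nat \<Rightarrow> nat \<Rightarrow> nat" where
  "binop_val Add a b = a + b"
| "binop_val Sub a b = a - b"
| "binop_val Mul a b = a * b"
| "binop_val Less a b = (if a < b then 1 else 0)"
| "binop_val Equal a b = (if a = b then 1 else 0)"

fun val :: "expr \<Rightarrow> state \<Rightarrow> nat" where
  "val (Const k) s = k"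
| "val (Read x e) s = s x (val e s)"
| "val (Bin f e1 e2) s = binop_val f (val e1 s) (val e2 s)"

fun cost :: "expr \<Rightarrow> nat" where
  "cost (Const k) = 1"
| "cost (Read x e) = 1 + cost e"
| "cost (Bin f e1 e2) = 1 + cost e1 + cost e2"

text \<open>
  \<open>fits W e s\<close>: all values occurring in the evaluation of \<open>e\<close>, including array indices, are at
  most \<open>W\<close>. The semantics below has no rule for expressions that do not fit, so a program that
  exceeds the word size has no terminating run. This makes unit cost per operation legitimate.
\<close>

fun fits :: "nat \<Rightarrow> expr \<Rightarrow> state \<Rightarrow> bool" where
  "fits W (Const k) s \<longleftrightarrow> k \<le> W"
| "fits W (Read x e) s \<longleftrightarrow> fits W e s \<and> val (Read x e) s \<le> W"
| "fits W (Bin f e1 e2) s \<longleftrightarrow> fits W e1 s \<and> fits W e2 s \<and> val (Bin f e1 e2) s \<le> W"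

text \<open>\<open>exec W c s t s'\<close>: with words in \<open>{0..W}\<close>, the program \<open>c\<close> started in \<open>s\<close> halts in \<open>s'\<close>
  after exactly \<open>t\<close> steps. Conditions are true iff nonzero.\<close>

inductive exec :: "nat \<Rightarrow> com \<Rightarrow> state \<Rightarrow> nat \<Rightarrow> state \<Rightarrow> bool" for W where
  Skip: "exec W Skip s 1 s"
| Write: "fits W i s \<Longrightarrow> fits W e s \<Longrightarrow>
    exec W (Write x i e) s (1 + cost i + cost e) (s(x := (s x)(val i s := val e s)))"
| Seq: "exec W c1 s t1 s' \<Longrightarrow> exec W c2 s' t2 s'' \<Longrightarrow> exec W (Seq c1 c2) s (t1 + t2) s''"
| IfTrue: "fits W b s \<Longrightarrow> val b s \<noteq> 0 \<Longrightarrow> exec W c1 s t s' \<Longrightarrow>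
    exec W (If b c1 c2) s (1 + cost b + t) s'"
| IfFalse: "fits W b s \<Longrightarrow> val b s = 0 \<Longrightarrow> exec W c2 s t s' \<Longrightarrow>
    exec W (If b c1 c2) s (1 + cost b + t) s'"
| WhileFalse: "fits W b s \<Longrightarrow> val b s = 0 \<Longrightarrow> exec W (While b c) s (1 + cost b) s"
| WhileTrue: "fits W b s \<Longrightarrow> val b s \<noteq> 0 \<Longrightarrow> exec W c s t1 s' \<Longrightarrow>
    exec W (While b c) s' t2 s'' \<Longrightarrow> exec W (While b c) s (1 + cost b + t1 + t2) s''"

lemma exec_deterministic:
  assumes "exec W c s t s'" and "exec W c s u s''"
  shows "t = u \<and> s' = s''"
  using assms
proof (induction arbitrary: u s'' rule: exec.induct)
  case (Skip s)
  from Skip.prems show ?case by cases auto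
next
  case (Write i s e x)
  from Write.prems show ?case by cases auto
next
  case (Seq c1 s t1 s1 c2 t2 s2)
  from Seq.prems show ?case
    by cases (metis Seq.IH)
next
  case (IfTrue b s c1 t s1 c2)
  from IfTrue.prems show ?case
    by cases (use IfTrue.IH IfTrue.hyps in \<open>metis\<close>)+
next
  case (IfFalse b s c2 t s1 c1)
  from IfFalse.prems show ?case
    by cases (use IfFalse.IH IfFalse.hyps in \<open>metis\<close>)+
next
  case (WhileFalse b s c)
  from WhileFalse.prems show ?case
    by cases (use WhileFalse.hyps in simp_all)
next
  case (WhileTrue b s c t1 s1 t2 s2)
  from WhileTrue.prems show ?case
    by cases (use WhileTrue.IH WhileTrue.hyps in \<open>metis\<close>)+
qed


section \<open>Input and output\<close>

text \<open>
  A graph with vertex set \<open>{..<n}\<close> is given by its adjacency matrix, stored row by row: the entry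
  for \<open>u\<close> and \<open>v\<close> is in cell \<open>u * n + v\<close>.
\<close>

definition adj :: "nat ugraph \<Rightarrow> nat \<Rightarrow> nat \<Rightarrow> nat" where
  "adj G u v = (if {u, v} \<in> edges G then 1 else 0)"

definition input :: "nat \<Rightarrow> nat ugraph \<Rightarrow> nat \<Rightarrow> nat \<Rightarrow> state" where
  "input n G x y = (\<lambda>_ _. 0)
     (''n'' := (\<lambda>_. 0)(0 := n),
      ''x'' := (\<lambda>_. 0)(0 := x),
      ''y'' := (\<lambda>_. 0)(0 := y),
      ''G'' := (\<lambda>i. if i < n * n then adj G (i div n) (i mod n) else 0))"

definition answer :: "state \<Rightarrow> nat" where
  "answer s = s ''answer'' 0"

definition outputs :: "state \<Rightarrow> nat \<Rightarrow> nat ugraph \<Rightarrow> bool" where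
  "outputs s n H \<longleftrightarrow> verts H = {..<n} \<and> (\<forall>u<n. \<forall>v<n. s ''H'' (u * n + v) = adj H u v)"

definition root_with_edge :: "'a ugraph \<Rightarrow> 'a \<Rightarrow> 'a \<Rightarrow> 'a ugraph \<Rightarrow> bool" where
  "root_with_edge G x y H \<longleftrightarrow>
     simple_graph H \<and> girth H \<ge> 6 \<and> square H = G \<and> {x, y} \<in> edges H"

end

theory Submission
  imports Defs
begin

text \<open>
  Let \<open>H\<close> have girth at least six. Two distinct vertices have at most one common neighbour in
  \<open>H\<close>, and none if they are adjacent, so \<open>H\<close> is a root of \<open>G\<close> exactly if
  \<open>G(u, v) = H(u, v) + |N(u) \<inter> N(v)|\<close> for \<open>u \<noteq> v\<close> and there is no 5-cycle; the absence of 5-cycles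
  says that every common \<open>G\<close>-neighbour of the ends of an edge \<open>uv\<close> of \<open>H\<close> is an \<open>H\<close>-neighbour of
  \<open>u\<close> or of \<open>v\<close>. All of this is checked in cubic time.

  For an edge \<open>uv\<close> of \<open>H\<close>, the common \<open>G\<close>-neighbours of \<open>u\<close> and \<open>v\<close> are \<open>N(u) - v\<close> and
  \<open>N(v) - u\<close>, two cliques of \<open>G\<close> with no edge of \<open>G\<close> between them. Hence \<open>N(u)\<close> determines
  \<open>N(v)\<close>, and thus \<open>H\<close> on the whole component, while an edge \<open>pw\<close> alone leaves two candidates for
  \<open>N(p)\<close>: take any common \<open>G\<close>-neighbour \<open>z\<close>, and its clique or the other one is \<open>N(p) - w\<close>.

  \<open>G\<close> may be disconnected. To try only linearly many pairs \<open>pw\<close> in total, each \<open>w\<close> is paired only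
  with the least vertex \<open>p\<close> of its closed \<open>G\<close>-neighbourhood. This suffices, since the least vertex
  of a component is paired with all its \<open>G\<close>-neighbours. The prescribed edge \<open>xy\<close> is one more
  condition in the check.
\<close>

section \<open>Roots of girth at least six\<close>

locale square_instance =
  fixes n x y :: nat and g :: "nat \<Rightarrow> nat \<Rightarrow> bool"
  assumes two_le_n: "2 \<le> n"
    and g_sym: "g u v \<Longrightarrow> g v u"
    and g_irrefl: "\<not> g u u"
    and g_bounded: "g u v \<Longrightarrow> u < n"
    and g_xy: "g x y"
begin

section \<open>The local root conditions and the rows they determine\<close>

definition between :: "(nat \<Rightarrow> nat \<Rightarrow> bool) \<Rightarrow> nat \<Rightarrow> nat \<Rightarrow> nat set" where
  "between h u v = {z. z < n \<and> h u z \<and> h z v}"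

text \<open>Relative to a set \<open>K\<close> of rows, so that parts of a disconnected graph can be
  certified one after another. As the left side of the count is 0 or 1, the count excludes triangles
  and 4-cycles besides describing the square; the clause after it excludes 5-cycles.\<close>

definition good :: "nat set \<Rightarrow> (nat \<Rightarrow> nat \<Rightarrow> bool) \<Rightarrow> bool" where
  "good K h \<longleftrightarrow> (\<forall>u\<in>K. \<forall>v<n.
     (h u v \<longrightarrow> v \<in> K \<and> h v u \<and> u \<noteq> v) \<and>
     (u \<noteq> v \<longrightarrow> of_bool (g u v) = of_bool (h u v) + card (between h u v)) \<and>
     (h u v \<longrightarrow> (\<forall>w<n. g u w \<longrightarrow> g v w \<longrightarrow> h u w \<or> h v w)) \<and>
     (u = x \<and> v = y \<longrightarrow> h u v))"

lemma g_bounded': "g u v \<Longrightarrow> v < n"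
  by (rule g_bounded, rule g_sym)

lemma finite_between [simp]: "finite (between h u v)"
  by (simp add: between_def)

lemma good_sym: "good K h \<Longrightarrow> u \<in> K \<Longrightarrow> v < n \<Longrightarrow> h u v \<Longrightarrow> v \<in> K \<and> h v u \<and> u \<noteq> v"
  unfolding good_def by blast

lemma good_count:
  "good K h \<Longrightarrow> u \<in> K \<Longrightarrow> v < n \<Longrightarrow> u \<noteq> v \<Longrightarrow>
    of_bool (g u v) = of_bool (h u v) + card (between h u v)"
  unfolding good_def by blast

lemma good_edge:
  assumes "good K h" "u \<in> K" "v < n" "h u v"
  shows "g u v"
  using good_count[OF assms(1-3)] good_sym[OF assms] assms(4) by (cases "g u v") auto

text \<open>The count allows a total of one, and the common neighbour \<open>z\<close> already uses
  it up.\<close>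

lemma good_path:
  assumes "good K h" "u \<in> K" "v < n" "z < n" "u \<noteq> v" "h u z" "h z v"
  shows "g u v" and "\<not> h u v" and "\<And>z'. z' < n \<Longrightarrow> h u z' \<Longrightarrow> h z' v \<Longrightarrow> z' = z"
proof -
  have count: "of_bool (g u v) = of_bool (h u v) + card (between h u v)"
    using good_count[OF assms(1-3,5)] .
  have z: "z \<in> between h u v" using assms(4,6,7) unfolding between_def by blast
  then have "card (between h u v) \<noteq> 0" by (metis card_0_eq finite_between empty_iff)
  then have one: "g u v \<and> \<not> h u v \<and> card (between h u v) = 1"
    using count by (cases "g u v"; cases "h u v") simp_all
  then show "g u v" "\<not> h u v" by simp_all
  fix z' assume "z' < n" "h u z'" "h z' v"
  then have "z' \<in> between h u v" unfolding between_def by blast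
  with z one show "z' = z" by (metis card_1_singletonE singletonD)
qed

lemma good_converse:
  assumes "good K h" "u \<in> K" "g u v"
  shows "h u v \<or> (\<exists>z<n. h u z \<and> h z v)"
proof (rule ccontr)
  assume neg: "\<not> ?thesis"
  then have "between h u v = {}" by (auto simp: between_def)
  moreover have "u \<noteq> v" using assms(3) g_irrefl by blast
  ultimately show False using good_count[OF assms(1,2) g_bounded'[OF assms(3)]] assms(3) neg by simp
qed

text \<open>By \<open>good_converse\<close> a \<open>g\<close>-edge is an \<open>h\<close>-edge or
  an \<open>h\<close>-path of length two, and \<open>h\<close> never leaves \<open>K\<close>. Hence
  a good set within the vertex range is a union of components of \<open>g\<close>.\<close>

lemma good_closed:
  assumes "good K h" "u \<in> K" "g u v"
  shows "v \<in> K"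
proof -
  have "v < n" using assms(3) by (rule g_bounded')
  from good_converse[OF assms] show ?thesis
  proof (elim disjE exE conjE)
    show ?thesis if "h u v" using good_sym[OF assms(1,2) \<open>v < n\<close> that] by blast
    show ?thesis if z: "z < n" "h u z" "h z v" for z
    proof -
      have "z \<in> K" using good_sym[OF assms(1,2) z(1,2)] by blast
      then show ?thesis using good_sym[OF assms(1) _ \<open>v < n\<close> z(3)] by blast
    qed
  qed
qed

text \<open>All clauses read only the row of some \<open>u\<close> in \<open>K\<close> or of an
  \<open>h\<close>-neighbour of \<open>u\<close>, which is again in \<open>K\<close>. This lets rows
  outside \<open>K\<close> be overwritten freely.\<close>

lemma good_cong:
  assumes h: "good K h" and eq: "\<And>u v. u \<in> K \<Longrightarrow> v < n \<Longrightarrow> h u v = h' u v"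
  shows "good K h'"
  unfolding good_def
proof (intro ballI allI impI conjI)
  fix u v assume uv: "u \<in> K" "v < n"
  have huv: "h u v" if "h' u v" using that eq[OF uv] by simp
  have row: "h v w = h' v w" if "h' u v" "w < n" for w
    using good_sym[OF h uv huv[OF that(1)]] eq[OF _ that(2), of v] by simp
  show "v \<in> K" "u \<noteq> v" if "h' u v" using good_sym[OF h uv huv[OF that]] by simp_all
  show "h' v u" if "h' u v"
  proof -
    \<comment> \<open>\<open>K\<close> may exceed the vertex range, so \<open>u < n\<close> is taken
      from the edge \<open>g u v\<close>.\<close>
    have "u < n" using good_edge[OF h uv huv[OF that]] g_bounded by blast
    then show ?thesis using good_sym[OF h uv huv[OF that]] row[OF that] by simp
  qed
  have "h' u z \<and> h' z v \<longleftrightarrow> h u z \<and> h z v" if "z < n" for z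
    using eq[OF uv(1) that] eq[OF _ uv(2), of z] good_sym[OF h uv(1) that] by blast
  then have "between h' u v = between h u v" unfolding between_def by blast
  then show "of_bool (g u v) = of_bool (h' u v) + card (between h' u v)" if "u \<noteq> v"
    using good_count[OF h uv that] eq[OF uv] by simp
  show "h' u w \<or> h' v w" if "h' u v" "w < n" "g u w" "g v w" for w
  proof -
    have "h u w \<or> h v w" using h[unfolded good_def, rule_format, OF uv] huv that by blast
    then show ?thesis using row[OF that(1,2)] eq[OF uv(1) that(2)] by simp
  qed
  show "h' u v" if "u = x \<and> v = y"
    using h[unfolded good_def, rule_format, OF uv] eq[OF uv] that by blast
qed

lemma good_Un:
  assumes "good K h" "good L h"
  shows "good (K \<union> L) h"
  using assms unfolding good_def by blast

lemma good_restrict: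
  assumes "good K h" "L \<subseteq> K" and "\<And>u v. u \<in> L \<Longrightarrow> v < n \<Longrightarrow> h u v \<Longrightarrow> v \<in> L"
  shows "good L h"
  using assms unfolding good_def by blast

text \<open>A neighbour \<open>a\<close> of \<open>v\<close> other than \<open>u\<close> ends the
  path \<open>u\<close>, \<open>v\<close>, \<open>a\<close>, so \<open>good_path\<close> applies.
  Conversely, the 5-cycle clause puts a common \<open>g\<close>-neighbour of \<open>u\<close> and
  \<open>v\<close> next to one of them.\<close>

lemma good_next_row:
  assumes h: "good {..<n} h" and b: "u < n" "v < n" "a < n" and uv: "h u v"
  shows "h v a \<longleftrightarrow> a = u \<or> g u a \<and> g v a \<and> \<not> h u a"
proof
  assume va: "h v a"
  show "a = u \<or> g u a \<and> g v a \<and> \<not> h u a"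
    using good_path(1,2)[OF h _ b(3,2) _ uv va] good_edge[OF h _ b(3) va] b(1,2) by auto
next
  assume "a = u \<or> g u a \<and> g v a \<and> \<not> h u a"
  then show "h v a"
  proof
    assume "a = u"
    then show ?thesis using good_sym[OF h _ b(2) uv] b(1) by simp
  next
    assume "g u a \<and> g v a \<and> \<not> h u a"
    then show ?thesis using h[unfolded good_def, rule_format, of u v] b uv by blast
  qed
qed

text \<open>Two neighbours of \<open>u\<close> have distance two and are joined in \<open>g\<close>.
  If \<open>a\<close> were next to \<open>v\<close> instead, an \<open>h\<close>-edge from
  \<open>z\<close> to \<open>a\<close> would give a 4-cycle, and an \<open>h\<close>-path of length
  two a 5-cycle, through \<open>z\<close>, \<open>u\<close>, \<open>v\<close>,
  \<open>a\<close>.\<close>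

lemma good_clique:
  assumes h: "good {..<n} h" and b: "u < n" "v < n" "a < n" "z < n" and uv: "h u v"
    and z: "h u z" "z \<noteq> v" and a: "g u a" "g v a"
  shows "h u a \<longleftrightarrow> a = z \<or> g z a"
proof
  assume ua: "h u a"
  have zu: "h z u" using good_sym[OF h _ b(4) z(1)] b(1) by simp
  show "a = z \<or> g z a" using good_path(1)[OF h _ b(3,1) _ zu ua] b(4) by auto
next
  assume az: "a = z \<or> g z a"
  have sym: "h q p" "p \<noteq> q" if "h p q" "p < n" "q < n" for p q
    using good_sym[OF h _ that(3,1)] that(2) by simp_all
  show "h u a"
  proof (rule ccontr)
    assume nua: "\<not> h u a"
    have ua: "u \<noteq> a" using a g_irrefl by blast
    have va: "h v a" using good_next_row[OF h b(1,2,3) uv] a nua by blast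
    have "g z a" using az nua z by blast
    have zu: "h z u" and vu: "h v u" and av: "h a v"
      using sym(1)[OF z(1) b(1,4)] sym(1)[OF uv b(1,2)] sym(1)[OF va b(2,3)] .
    have za: "z \<noteq> a" using \<open>g z a\<close> g_irrefl by blast
    have zv: "\<not> h z v" using good_path(2)[OF h _ b(2,1) z(2) zu uv] b(4) by simp
    have "\<not> h z a" using good_path(3)[OF h _ b(2,1) z(2) zu uv b(3) _ av] b(4) ua by auto
    then obtain q where q: "q < n" "h z q" "h q a"
      using good_converse[OF h _ \<open>g z a\<close>] b(4) by blast
    have qu: "u \<noteq> q" using q(3) nua by blast
    have qv: "v \<noteq> q" using q(2) zv by blast
    have aq: "h a q" using sym(1)[OF q(3,1) b(3)] .
    have uq: "g u q" "\<not> h u q" using good_path(1,2)[OF h _ q(1) b(4) qu z(1) q(2)] b(1) by simp_all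
    have vq: "g v q" "\<not> h v q" using good_path(1,2)[OF h _ q(1) b(3) qv va aq] b(2) by simp_all
    \<comment> \<open>\<open>q\<close> is joined in \<open>g\<close> to \<open>u\<close> through
      \<open>z\<close> and to \<open>v\<close> through \<open>a\<close>, but to neither in
      \<open>h\<close>, against the 5-cycle clause.\<close>
    show False using h[unfolded good_def, rule_format, of u v] b(1,2) uv q(1) uq vq by blast
  qed
qed

text \<open>\<open>b\<close> selects the clique containing \<open>z\<close> or the other one; \<open>p = w\<close> serves isolated vertices.\<close>

definition root_row :: "nat \<Rightarrow> nat \<Rightarrow> nat \<Rightarrow> bool \<Rightarrow> nat \<Rightarrow> bool" where
  "root_row p w z b v \<longleftrightarrow> g p v \<and> (v = w \<or> g w v \<and> ((v = z \<or> g z v) = b))"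

text \<open>If \<open>p\<close> is not isolated, \<open>w\<close> is a neighbour of \<open>p\<close>
  in the root, and \<open>b\<close> says whether \<open>z\<close> lies on the side of
  \<open>p\<close> or of \<open>w\<close>. The quantifier over \<open>z\<close> comes after
  \<open>w\<close> so that any common neighbour may be chosen; without one the row is just
  \<open>w\<close>, whatever \<open>z\<close> and \<open>b\<close> are.\<close>

lemma root_row_exists:
  assumes h: "good {..<n} h" and p: "p < n"
  shows "\<exists>w<n. (w = p \<or> g w p) \<and>
    (\<forall>z. g p z \<and> g w z \<or> (\<forall>a. \<not> (g p a \<and> g w a)) \<longrightarrow>
      (\<exists>b. \<forall>v<n. root_row p w z b v = h p v))"
proof (cases "\<exists>w<n. h p w")
  case False
  then have "\<not> g p v" for v using good_converse[OF h, of p v] p False g_bounded'[of p v] by auto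
  with False p show ?thesis unfolding root_row_def by (intro exI[of _ p]) auto
next
  case True
  then obtain w where w: "w < n" "h p w" by blast
  have wp: "h w p" using good_sym[OF h _ w] p by simp
  have gpw: "g p w" using good_edge[OF h _ w] p by simp
  have row: "h p v \<longleftrightarrow> g p v \<and> (v = w \<or> g w v \<and> h p v)" if "v < n" for v
    using good_edge[OF h _ that, of p] good_path(1)[OF h _ that p _ wp] p w by blast
  have "\<exists>b. \<forall>v<n. root_row p w z b v = h p v"
    if z: "g p z \<and> g w z \<or> (\<forall>a. \<not> (g p a \<and> g w a))" for z
    using z
  proof
    assume z: "g p z \<and> g w z"
    then have zn: "z < n" and zw: "z \<noteq> w" and zp: "z \<noteq> p" using g_bounded' g_irrefl by blast+
    show ?thesis
    proof (cases "h p z")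
      case True
      then have "h p v \<longleftrightarrow> v = z \<or> g z v" if "v < n" "g p v" "g w v" for v
        using good_clique[OF h p w(1) that(1) zn w(2) True zw that(2,3)] by simp
      then show ?thesis using row unfolding root_row_def by (intro exI[of _ True]) blast
    next
      case False
      \<comment> \<open>Now \<open>z\<close> is next to \<open>w\<close>, so the clique of
        \<open>z\<close> is cut out with \<open>p\<close> and \<open>w\<close> exchanged and then
        complemented.\<close>
      then have wz: "h w z" using good_next_row[OF h p w(1) zn w(2)] z by auto
      have "h w v \<longleftrightarrow> v = z \<or> g z v" if "v < n" "g p v" "g w v" for v
        using good_clique[OF h w(1) p that(1) zn wp wz zp that(3,2)] by simp
      moreover have "h w v \<longleftrightarrow> \<not> h p v" if "v < n" "g p v" "g w v" for v
        using good_next_row[OF h p w(1) that(1) w(2)] that g_irrefl by auto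
      ultimately show ?thesis using row unfolding root_row_def by (intro exI[of _ False]) blast
    qed
  next
    assume "\<forall>a. \<not> (g p a \<and> g w a)"
    then show ?thesis using row unfolding root_row_def by blast
  qed
  then show ?thesis using w g_sym[OF gpw] by blast
qed

end

section \<open>Girth and distance expressed by explicit short walks\<close>

lemma girth_ge_iff: "enat k \<le> girth H \<longleftrightarrow> (\<forall>p. cycle H p \<longrightarrow> k \<le> walk_length p)"
  by (simp add: girth_def le_INF_iff)

lemma walk_Cons2: "walk H (a # b # p) \<longleftrightarrow> a \<in> verts H \<and> {a, b} \<in> edges H \<and> walk H (b # p)"
  unfolding walk_def by (auto simp: less_Suc_eq_0_disj nth_Cons split: nat.splits)

lemma walk_single: "walk H [a] \<longleftrightarrow> a \<in> verts H"
  by (simp add: walk_def)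

lemma walk_le_2_cases:
  assumes "walk_length p \<le> 2" "p \<noteq> []"
  obtains a where "p = [a]" | a b where "p = [a, b]" | a b c where "p = [a, b, c]"
proof -
  have "length p \<le> 3" using assms by (simp add: walk_length_def)
  with assms(2) that show ?thesis
    by (cases p; cases "tl p"; cases "tl (tl p)") auto
qed

lemma distance_le_2_iff:
  assumes "u \<in> verts H" "v \<in> verts H" 
  shows "distance H u v \<le> 2 \<longleftrightarrow> u = v \<or> {u, v} \<in> edges H \<or>
    (\<exists>z\<in>verts H. {u, z} \<in> edges H \<and> {z, v} \<in> edges H)"
proof -
  \<comment> \<open>A strict comparison with an infimum yields a witnessing walk, hence the passage
    from at most 2 to \<open>< 3\<close>.\<close>
  have "distance H u v \<le> 2 \<longleftrightarrow> distance H u v < 3"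
    by (cases "distance H u v") (auto simp: numeral_eq_enat)
  also have "\<dots> \<longleftrightarrow> (\<exists>p. walk H p \<and> hd p = u \<and> last p = v \<and> walk_length p \<le> 2)"
    by (auto simp: distance_def INF_less_iff numeral_eq_enat)
  also have "\<dots> \<longleftrightarrow> u = v \<or> {u, v} \<in> edges H \<or>
    (\<exists>z\<in>verts H. {u, z} \<in> edges H \<and> {z, v} \<in> edges H)" (is "?L \<longleftrightarrow> ?R")
  proof
    assume ?L
    then obtain p where p: "walk H p" "hd p = u" "last p = v" "walk_length p \<le> 2" by blast
    then have "p \<noteq> []" by (auto simp: walk_def)
    with p(4) show ?R
      by (cases rule: walk_le_2_cases) (use p in \<open>auto simp: walk_Cons2 walk_single\<close>)
  next
    assume ?R
    then consider "u = v" | "{u, v} \<in> edges H"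
      | z where "z \<in> verts H" "{u, z} \<in> edges H" "{z, v} \<in> edges H" by blast
    then show ?L
    proof cases
      case 1
      then show ?thesis using assms by (intro exI[of _ "[u]"]) (simp add: walk_single walk_length_def)
    next
      case 2
      then show ?thesis using assms
        by (intro exI[of _ "[u, v]"]) (simp add: walk_single walk_Cons2 walk_length_def)
    next
      case 3
      then show ?thesis using assms
        by (intro exI[of _ "[u, z, v]"]) (simp add: walk_single walk_Cons2 walk_length_def)
    qed
  qed
  finally show ?thesis .
qed


lemma cycle_Cons2:
  "cycle H (a # b # p) \<longleftrightarrow> walk H (a # b # p) \<and> a = last (b # p) \<and> distinct (b # p) \<and> length p \<ge> 2"
  by (auto simp: cycle_def walk_length_def)

text \<open>The list repeats its start, so the lengths 3 to 5 mean 4 to 6 entries.\<close>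

lemma short_cycle_cases:
  assumes "cycle H p" "walk_length p < 6"
  obtains a b c where "p = [a, b, c, a]" | a b c d where "p = [a, b, c, d, a]"
    | a b c d e where "p = [a, b, c, d, e, a]"
proof -
  have l: "length p = 4 \<or> length p = 5 \<or> length p = 6"
    using assms by (auto simp: cycle_def walk_length_def)
  have "hd p = last p" using assms(1) by (simp add: cycle_def)
  with l that show ?thesis by (auto simp: eval_nat_numeral length_Suc_conv)
qed

section \<open>Equivalence of the local conditions with being a root\<close>

context square_instance begin

lemma root_with_edge_imp_good:
  assumes G: "verts G = {..<n}" and g: "\<And>u v. g u v \<longleftrightarrow> {u, v} \<in> edges G"
    and H: "root_with_edge G x y H"
  shows "good {..<n} (\<lambda>u v. {u, v} \<in> edges H)"
proof -
  let ?h = "\<lambda>u v. {u, v} \<in> edges H"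
  have simple: "simple_graph H" and girth: "girth H \<ge> 6" and sq: "square H = G"
    and xy: "{x, y} \<in> edges H" using H unfolding root_with_edge_def by blast+
  have V: "verts H = {..<n}" using G unfolding sq[symmetric] square_def by simp
  have ne: "u \<noteq> v" and bd: "u < n" if "?h u v" for u v
  proof -
    have "{u, v} \<subseteq> {..<n}" "card {u, v} = 2"
      using simple[unfolded simple_graph_def, THEN conjunct2, THEN bspec, OF that] unfolding V by blast+
    then show "u \<noteq> v" "u < n" by auto
  qed
  have sym: "?h v u" if "?h u v" for u v using that by (metis insert_commute)
  have girth: "6 \<le> walk_length p" if "cycle H p" for p
    using girth girth_ge_iff[of 6 H] that by (simp add: numeral_eq_enat)
  have g': "g u v \<longleftrightarrow> u \<noteq> v \<and> (?h u v \<or> (\<exists>z<n. ?h u z \<and> ?h z v))" (is "_ \<longleftrightarrow> ?R u v")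
    if "u < n" "v < n" for u v
  proof -
    have R: "u \<noteq> v \<and> distance H u v \<le> 2 \<longleftrightarrow> ?R u v" if "u < n" "v < n" for u v
      using that by (auto simp: distance_le_2_iff V)
    \<comment> \<open>An edge of the square is an unordered pair, so its witnesses may appear in
      either order.\<close>
    have Rsym: "?R v u" if "?R u v" for u v
      using that sym by blast
    have "g u v \<longleftrightarrow> (\<exists>u' v'. {u, v} = {u', v'} \<and> u' < n \<and> v' < n \<and> (u' \<noteq> v' \<and> distance H u' v' \<le> 2))"
    proof -
      have "edges G = {{u, v} |u v. u < n \<and> v < n \<and> u \<noteq> v \<and> distance H u v \<le> 2}"
        unfolding sq[symmetric] square_def V by simp
      then show ?thesis unfolding g by (simp only: mem_Collect_eq)
    qed
    also have "\<dots> \<longleftrightarrow> (\<exists>u' v'. {u, v} = {u', v'} \<and> u' < n \<and> v' < n \<and> ?R u' v')"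
      by (rule ex_cong1, rule ex_cong1, rule conj_cong, rule refl, rule conj_cong, rule refl,
          rule conj_cong, rule refl, rule R)
    also have "\<dots> \<longleftrightarrow> ?R u v"
    proof
      assume "\<exists>u' v'. {u, v} = {u', v'} \<and> u' < n \<and> v' < n \<and> ?R u' v'"
      then obtain u' v' where "u = u' \<and> v = v' \<or> u = v' \<and> v = u'" "?R u' v'"
        unfolding doubleton_eq_iff by blast
      then show "?R u v" using Rsym[of u' v'] by metis
    next
      assume "?R u v"
      with that show "\<exists>u' v'. {u, v} = {u', v'} \<and> u' < n \<and> v' < n \<and> ?R u' v'" by blast
    qed
    finally show ?thesis .
  qed
  have no3: False if "?h a b" "?h b c" "?h c a" for a b c
  proof -
    have "cycle H [a, b, c, a]" using that ne bd V by (auto simp: cycle_Cons2 walk_Cons2 walk_single)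
    from girth[OF this] show False by (simp add: walk_length_def)
  qed
  have no4: False if "?h a b" "?h b c" "?h c d" "?h d a" "a \<noteq> c" "b \<noteq> d" for a b c d
  proof -
    have "cycle H [a, b, c, d, a]"
      using that ne bd V by (auto simp: cycle_Cons2 walk_Cons2 walk_single)
    from girth[OF this] show False by (simp add: walk_length_def)
  qed
  have no5: False if "?h a b" "?h b c" "?h c d" "?h d e" "?h e a"
    "distinct [a, b, c, d, e]" for a b c d e
  proof -
    have "cycle H [a, b, c, d, e, a]"
      using that ne bd V by (auto simp: cycle_Cons2 walk_Cons2 walk_single)
    from girth[OF this] show False by (simp add: walk_length_def)
  qed
  show ?thesis
    unfolding good_def
  proof (intro ballI allI impI conjI)
    fix u v assume "u \<in> {..<n}" "v < n"
    then have uv: "u < n" "v < n" by auto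
    show "v \<in> {..<n}" using uv by simp
    show "?h v u" "u \<noteq> v" if "?h u v" using sym ne that by blast+
    show "?h u v" if "u = x \<and> v = y" using that xy by simp
    show "of_bool (g u v) = of_bool (?h u v) + card (between ?h u v)" if "u \<noteq> v"
    proof (cases "\<exists>z<n. ?h u z \<and> ?h z v")
      case True
      then obtain z where z: "z < n" "?h u z" "?h z v" by blast
      \<comment> \<open>A second common neighbour would close the 4-cycle \<open>u\<close>,
        \<open>z\<close>, \<open>v\<close>, \<open>z'\<close>.\<close>
      have "z' = z" if "?h u z'" "?h z' v" for z'
        using no4[of u z v z'] z that sym \<open>u \<noteq> v\<close> by blast
      then have "between ?h u v = {z}" unfolding between_def using z by blast
      moreover have "\<not> ?h u v" using no3[of u z v] z sym by blast
      moreover have "g u v" using g'[OF uv] z that by blast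
      ultimately show ?thesis by simp
    next
      case False
      then have "between ?h u v = {}" by (auto simp: between_def)
      with False g'[OF uv] that show ?thesis by simp
    qed
    show "?h u w \<or> ?h v w" if huv: "?h u v" and w: "w < n" "g u w" "g v w" for w
    proof (rule ccontr)
      assume neg: "\<not> (?h u w \<or> ?h v w)"
      \<comment> \<open>\<open>w\<close> has distance two from both \<open>u\<close> and
        \<open>v\<close>; the two midpoints complete the 5-cycle \<open>u\<close>, \<open>v\<close>,
        \<open>b\<close>, \<open>w\<close>, \<open>a\<close>.\<close>
      obtain a where a: "?h u a" "?h a w" using g'[OF uv(1) w(1)] w neg by blast
      obtain b where b: "?h v b" "?h b w" using g'[OF uv(2) w(1)] w neg by blast
      have "u \<noteq> w" "v \<noteq> w" using that g_irrefl by blast+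
      have "a \<noteq> b" using no3[of u v a] huv a b sym by blast
      moreover have "a \<noteq> v" "b \<noteq> u" using neg a b by blast+
      ultimately show False
        using no5[of u v b w a] huv a b sym ne \<open>u \<noteq> w\<close> \<open>v \<noteq> w\<close> by auto
    qed
  qed
qed

lemma good_imp_root_with_edge:
  assumes simple_G: "simple_graph G" and G: "verts G = {..<n}"
    and g: "\<And>u v. g u v \<longleftrightarrow> {u, v} \<in> edges G"
    and good: "good {..<n} h" and H: "H = \<lparr>verts = {..<n}, edges = {{u, v} |u v. u < n \<and> v < n \<and> h u v}\<rparr>"
  shows "root_with_edge G x y H" and "\<And>u v. u < n \<Longrightarrow> v < n \<Longrightarrow> {u, v} \<in> edges H \<longleftrightarrow> h u v"
proof -
  have sym: "h v u" "u \<noteq> v" if "u < n" "v < n" "h u v" for u v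
    using good_sym[OF good _ that(2,3)] that(1) by simp_all
  show edge: "{u, v} \<in> edges H \<longleftrightarrow> h u v" if "u < n" "v < n" for u v
    using that sym(1)[of u v] sym(1)[of v u] by (auto simp: H doubleton_eq_iff)
  have V: "verts H = {..<n}" by (simp add: H)
  have bd: "u < n \<and> v < n \<and> h u v" if "{u, v} \<in> edges H" for u v
    using that sym(1)[of v u] by (auto simp: H doubleton_eq_iff)
  have simple: "simple_graph H"
    using sym(2) by (force simp: simple_graph_def H)
  have count: "card (between h u v) \<le> 1" if "u < n" "v < n" "u \<noteq> v" for u v
    using good_count[OF good _ that(2,3)] that(1) by (auto split: if_splits simp: of_bool_def)
  have no3: False if "h a b" "h b c" "h c a" "a < n" "b < n" "c < n" for a b c
    using good_path(2)[OF good _ that(5,6) _ sym(1)[OF that(6,4,3)] sym(1)[OF that(5,6,2)]]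
      that sym(2) by blast
  have girth: "6 \<le> walk_length p" if p: "cycle H p" for p
  proof (rule ccontr)
    assume "\<not> 6 \<le> walk_length p"
    then have "walk_length p < 6" by simp
    with p show False
    proof (cases rule: short_cycle_cases)
      case (1 a b c)
      then have "h a b" "h b c" "h c a" "a < n" "b < n" "c < n"
        using p bd by (auto simp: cycle_Cons2 walk_Cons2)
      then show False by (rule no3)
    next
      case (2 a b c d)
      then have *: "h a b" "h b c" "h c d" "h d a" "a < n" "b < n" "c < n" "d < n" "b \<noteq> d" "a \<noteq> c"
        using p bd by (auto simp: cycle_Cons2 walk_Cons2)
      have "d = b"
        using good_path(3)[OF good _ *(7,6,10,1,2,8) sym(1)[OF *(8,5,4)] sym(1)[OF *(7,8,3)]] *(5) by simp
      with * show False by simp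
    next
      case (3 a b c d e)
      then have *: "h a b" "h b c" "h c d" "h d e" "h e a" "a < n" "b < n" "c < n" "d < n" "e < n"
        "d \<noteq> a" "b \<noteq> d"
        using p bd by (auto simp: cycle_Cons2 walk_Cons2)
      \<comment> \<open>In a 5-cycle \<open>d\<close> is joined in \<open>g\<close> to both
        \<open>a\<close> and \<open>b\<close>, so it is next to one of them in \<open>h\<close>, and
        that chord closes a triangle.\<close>
      have "g b d" using good_path(1)[OF good _ *(9,8,12,2,3)] *(7) by simp
      moreover have "g a d"
        using good_path(1)[OF good _ *(6,10,11,4,5)] *(9) g_sym by simp
      ultimately have "h a d \<or> h b d"
        using good[unfolded good_def, rule_format, of a b] * by blast
      then show False
        using no3[OF _ *(4,5)] no3[OF *(2,3)] * sym(1)[of b d] by blast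
    qed
  qed
  have "edges (square H) = edges G"
  proof (rule set_eqI)
    have "(\<exists>u v. e = {u, v} \<and> u < n \<and> v < n \<and> u \<noteq> v \<and> distance H u v \<le> 2)
      \<longleftrightarrow> (\<exists>u v. e = {u, v} \<and> u < n \<and> v < n \<and> g u v)" for e
    proof (intro ex_cong1 conj_cong refl)
      fix u v assume uv: "e = {u, v}" "u < n" "v < n"
      have *: "(\<exists>z\<in>verts H. {u, z} \<in> edges H \<and> {z, v} \<in> edges H) \<longleftrightarrow> (\<exists>z<n. h u z \<and> h z v)"
        using uv V edge by auto
      show "(u \<noteq> v \<and> distance H u v \<le> 2) \<longleftrightarrow> g u v"
        using good_converse[OF good, of u v] good_edge[OF good _ uv(3), of u]
          good_path(1)[OF good _ uv(3), of u] g_irrefl uv V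
        by (auto simp: distance_le_2_iff edge *)
    qed
    moreover have "e \<in> edges G \<longleftrightarrow> (\<exists>u v. e = {u, v} \<and> u < n \<and> v < n \<and> g u v)" for e
      using simple_G g_bounded g_bounded' unfolding simple_graph_def g by (metis card_2_iff)
    ultimately show "e \<in> edges (square H) \<longleftrightarrow> e \<in> edges G" for e
      by (simp add: square_def V)
  qed
  moreover have "verts (square H) = verts G" by (simp add: square_def V G)
  ultimately have sq: "square H = G" by simp
  have "h x y" using good g_bounded g_bounded' g_xy unfolding good_def by blast
  then have "{x, y} \<in> edges H" using edge[OF g_bounded g_bounded'] g_xy by blast
  then show "root_with_edge G x y H"
    using simple girth sq girth_ge_iff[of 6 H] by (simp add: root_with_edge_def numeral_eq_enat)
qed

end

section \<open>Total correctness with time bounds\<close>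

text \<open>
  For \<open>n \<ge> 2\<close> and memory cells bounded by \<open>n\<close>, the value of \<open>e\<close> is at most \<open>n ^ val_degree e\<close>, and all
  values occurring in its evaluation are at most \<open>n ^ fits_degree e\<close>. The clause for constants uses
  \<open>k \<le> 2 ^ k\<close>.
\<close>

fun val_degree :: "expr \<Rightarrow> nat" where
  "val_degree (Const k) = max 1 k"
| "val_degree (Read x e) = 1"
| "val_degree (Bin Add e1 e2) = Suc (max (val_degree e1) (val_degree e2))"
| "val_degree (Bin Mul e1 e2) = val_degree e1 + val_degree e2"
| "val_degree (Bin Sub e1 e2) = val_degree e1"
| "val_degree (Bin Less e1 e2) = 1"
| "val_degree (Bin Equal e1 e2) = 1"

fun fits_degree :: "expr \<Rightarrow> nat" where
  "fits_degree (Const k) = max 1 k"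
| "fits_degree (Read x e) = fits_degree e"
| "fits_degree (Bin f e1 e2) = max (val_degree (Bin f e1 e2)) (max (fits_degree e1) (fits_degree e2))"

definition bounded :: "nat \<Rightarrow> state \<Rightarrow> bool" where
  "bounded n s \<longleftrightarrow> (\<forall>x i. s x i \<le> n)"

lemma boundedD: "bounded n s \<Longrightarrow> s x i \<le> n"
  by (simp add: bounded_def)

lemma val_le_power:
  assumes "2 \<le> n" "bounded n s"
  shows "val e s \<le> n ^ val_degree e"
proof (induction e rule: val_degree.induct)
  case (1 k)
  have "k \<le> max 1 k" by simp
  also have "\<dots> \<le> 2 ^ max 1 k" using less_exp[of "max 1 k"] by (rule less_imp_le)
  also have "\<dots> \<le> n ^ max 1 k" using assms(1) by (rule power_mono) simp
  finally show ?case by simp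
next
  case (3 e1 e2)
  let ?m = "max (val_degree e1) (val_degree e2)"
  have "n ^ val_degree e1 \<le> n ^ ?m" "n ^ val_degree e2 \<le> n ^ ?m"
    using assms(1) by (auto intro!: power_increasing)
  then have "val e1 s + val e2 s \<le> 2 * n ^ ?m" using 3 by linarith
  \<comment> \<open>Here \<open>2 \<le> n\<close> pays for the sum of two values with one more
    factor \<open>n\<close>.\<close>
  also have "\<dots> \<le> n * n ^ ?m" using assms(1) by simp
  finally show ?case by simp
next
  case (4 e1 e2)
  then show ?case by (simp add: power_add mult_le_mono)
qed (use assms boundedD in \<open>auto intro: diff_le_self[THEN le_trans]\<close>)

lemma fits_degree_pos: "1 \<le> fits_degree e"
  by (induction e) (auto simp: le_max_iff_disj)

lemma fits_if_degree:
  assumes "2 \<le> n" "bounded n s" "fits_degree e \<le> d"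
  shows "fits (n ^ d) e s"
proof -
  have mono: "n ^ a \<le> n ^ d" if "a \<le> d" for a
    using that assms(1) by (auto intro: power_increasing)
  show ?thesis using assms(3)
  proof (induction e)
    case (Const k)
    have "k \<le> n ^ max 1 k" using val_le_power[OF assms(1,2), of "Const k"] by simp
    also have "\<dots> \<le> n ^ d" using mono Const by simp
    finally show ?case by simp
  next
    case (Read x e)
    have "1 \<le> d" using Read.prems fits_degree_pos[of e] by simp
    then have "n \<le> n ^ d" using mono[of 1] by simp
    then show ?case using Read boundedD[OF assms(2)] le_trans by fastforce
  next
    case (Bin f e1 e2)
    have "val (Bin f e1 e2) s \<le> n ^ d"
      using val_le_power[OF assms(1,2)] mono[of "val_degree (Bin f e1 e2)"] Bin.prems le_trans
      by fastforce
    then show ?case using Bin by simp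
  qed
qed

section \<open>Time bounds and rules for total correctness\<close>

fun writes :: "com \<Rightarrow> vname set" where
  "writes Skip = {}"
| "writes (Write x i e) = {x}"
| "writes (Seq c1 c2) = writes c1 \<union> writes c2"
| "writes (If b c1 c2) = writes c1 \<union> writes c2"
| "writes (While b c) = writes c"

lemma exec_unchanged: "exec W c s t s' \<Longrightarrow> x \<notin> writes c \<Longrightarrow> s' x = s x"
  by (induction rule: exec.induct) auto

text \<open>A \<open>While\<close> is charged \<open>n\<close> iterations, which need not be true of
  an arbitrary loop; \<open>wp\<close> demands the bound explicitly and \<open>wp_While\<close>
  establishes it for counting loops. An \<open>If\<close> is charged both branches, which avoids a
  maximum.\<close>

fun time_bound :: "nat \<Rightarrow> com \<Rightarrow> nat" where
  "time_bound n Skip = 1"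
| "time_bound n (Write x i e) = 1 + cost i + cost e"
| "time_bound n (Seq c1 c2) = time_bound n c1 + time_bound n c2"
| "time_bound n (If b c1 c2) = 1 + cost b + (time_bound n c1 + time_bound n c2)"
| "time_bound n (While b c) = 1 + cost b + n * (1 + cost b + time_bound n c)"

fun loop_depth :: "com \<Rightarrow> nat" where
  "loop_depth Skip = 0"
| "loop_depth (Write x i e) = 0"
| "loop_depth (Seq c1 c2) = max (loop_depth c1) (loop_depth c2)"
| "loop_depth (If b c1 c2) = max (loop_depth c1) (loop_depth c2)"
| "loop_depth (While b c) = Suc (loop_depth c)"

text \<open>Each level of nesting contributes one factor \<open>n\<close>; since \<open>n\<close> is
  positive, terms of lower degree are absorbed into the leading power.\<close>

lemma time_bound_le_power: "\<exists>C. \<forall>n\<ge>1. time_bound n c \<le> C * n ^ loop_depth c"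
proof (induction c)
  case Skip
  show ?case by (intro exI[of _ 1]) simp
next
  case (Write x i e)
  show ?case by (intro exI[of _ "1 + cost i + cost e"]) simp
next
  case (Seq c1 c2)
  then obtain C1 C2 where C: "\<forall>n\<ge>1. time_bound n c1 \<le> C1 * n ^ loop_depth c1"
    "\<forall>n\<ge>1. time_bound n c2 \<le> C2 * n ^ loop_depth c2" by blast
  have "time_bound n (Seq c1 c2) \<le> (C1 + C2) * n ^ loop_depth (Seq c1 c2)" if "n \<ge> 1" for n
  proof -
    have "C1 * n ^ loop_depth c1 \<le> C1 * n ^ loop_depth (Seq c1 c2)"
      "C2 * n ^ loop_depth c2 \<le> C2 * n ^ loop_depth (Seq c1 c2)"
      using that by (auto intro!: mult_left_mono power_increasing)
    with C that have "time_bound n c1 \<le> C1 * n ^ loop_depth (Seq c1 c2)"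
      "time_bound n c2 \<le> C2 * n ^ loop_depth (Seq c1 c2)" using le_trans by blast+
    then show ?thesis by (simp add: algebra_simps)
  qed
  then show ?case by blast
next
  case (If b c1 c2)
  then obtain C1 C2 where C: "\<forall>n\<ge>1. time_bound n c1 \<le> C1 * n ^ loop_depth c1"
    "\<forall>n\<ge>1. time_bound n c2 \<le> C2 * n ^ loop_depth c2" by blast
  have "time_bound n (If b c1 c2) \<le> (1 + cost b + C1 + C2) * n ^ loop_depth (If b c1 c2)"
    if "n \<ge> 1" for n
  proof -
    let ?N = "n ^ loop_depth (If b c1 c2)"
    have "C1 * n ^ loop_depth c1 \<le> C1 * ?N" "C2 * n ^ loop_depth c2 \<le> C2 * ?N"
      using that by (auto intro!: mult_left_mono power_increasing)
    with C that have "time_bound n c1 \<le> C1 * ?N" "time_bound n c2 \<le> C2 * ?N"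
      using le_trans by blast+
    moreover have "(1 + cost b) * 1 \<le> (1 + cost b) * ?N" using that by (intro mult_left_mono) simp_all
    ultimately show ?thesis by (simp add: algebra_simps)
  qed
  then show ?case by blast
next
  case (While b c)
  then obtain C where C: "\<forall>n\<ge>1. time_bound n c \<le> C * n ^ loop_depth c" by blast
  have "time_bound n (While b c) \<le> (2 * (1 + cost b) + C) * n ^ Suc (loop_depth c)"
    if "n \<ge> 1" for n
  proof -
    let ?B = "1 + cost b" and ?N = "n ^ loop_depth c"
    have N: "1 \<le> ?N" using that by simp
    have "time_bound n (While b c) = ?B + (?B * n + n * time_bound n c)"
      by (simp add: algebra_simps)
    also have "\<dots> \<le> ?B * (n * ?N) + (?B * (n * ?N) + n * (C * ?N))"
    proof (intro add_mono)
      have "1 \<le> n * ?N" using that N by simp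
      then have "?B * 1 \<le> ?B * (n * ?N)" by (rule mult_le_mono2)
      then show "?B \<le> ?B * (n * ?N)" by (simp only: mult_1_right)
      show "?B * n \<le> ?B * (n * ?N)" using N by (intro mult_le_mono2) simp
      show "n * time_bound n c \<le> n * (C * ?N)" using C that by (intro mult_le_mono2) blast
    qed
    also have "\<dots> = (2 * ?B + C) * n ^ Suc (loop_depth c)"
      by (simp add: algebra_simps)
    finally show ?thesis .
  qed
  then show ?case by (metis loop_depth.simps(5))
qed

text \<open>The word size \<open>n ^ 20\<close> is generous: it only has to exceed the degrees of the expressions used.\<close>

definition wp :: "nat \<Rightarrow> com \<Rightarrow> state \<Rightarrow> (state \<Rightarrow> bool) \<Rightarrow> bool" where
  "wp n c s Q \<longleftrightarrow> (\<exists>t s'. exec (n ^ 20) c s t s' \<and> t \<le> time_bound n c \<and> bounded n s' \<and> Q s')"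

text \<open>Boundedness and the frame condition come for free, so the postconditions below need not
  list the arrays left unchanged.\<close>

lemma wp_mono:
  assumes "wp n c s Q"
    and "\<And>s'. bounded n s' \<Longrightarrow> (\<And>x. x \<notin> writes c \<Longrightarrow> s' x = s x) \<Longrightarrow> Q s' \<Longrightarrow> R s'"
  shows "wp n c s R"
  using assms exec_unchanged unfolding wp_def by metis

lemma wp_Skip: "bounded n s \<Longrightarrow> Q s \<Longrightarrow> wp n Skip s Q"
  unfolding wp_def by (intro exI conjI) (auto intro: exec.Skip)

text \<open>Only the stored value has to stay at most \<open>n\<close>; intermediate values and the
  index may be larger, as the degree bounds keep them within the word size.\<close>

lemma wp_Write:
  assumes "2 \<le> n" "bounded n s" "fits_degree i \<le> 20" "fits_degree e \<le> 20" "val e s \<le> n"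
    and "Q (s(x := (s x)(val i s := val e s)))"
  shows "wp n (Write x i e) s Q"
  unfolding wp_def
proof (intro exI conjI)
  show "exec (n ^ 20) (Write x i e) s (1 + cost i + cost e) (s(x := (s x)(val i s := val e s)))"
    using assms by (intro exec.Write fits_if_degree)
qed (use assms in \<open>auto simp: bounded_def\<close>)

lemma wp_Seq:
  assumes "wp n c1 s R"
    and "\<And>s'. bounded n s' \<Longrightarrow> (\<And>x. x \<notin> writes c1 \<Longrightarrow> s' x = s x) \<Longrightarrow> R s' \<Longrightarrow> wp n c2 s' Q"
  shows "wp n (Seq c1 c2) s Q"
proof -
  from assms(1) obtain t s' where 1: "exec (n ^ 20) c1 s t s'" "t \<le> time_bound n c1" "bounded n s'" "R s'"
    unfolding wp_def by blast
  then have "wp n c2 s' Q" using exec_unchanged assms(2) by blast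
  then obtain t' s'' where 2: "exec (n ^ 20) c2 s' t' s''" "t' \<le> time_bound n c2" "bounded n s''" "Q s''"
    unfolding wp_def by blast
  then show ?thesis using 1 exec.Seq[OF 1(1) 2(1)] unfolding wp_def
    by (intro exI[of _ "t + t'"] exI[of _ s'']) auto
qed

lemma wp_If:
  assumes "2 \<le> n" "bounded n s" "fits_degree b \<le> 20"
    and "val b s \<noteq> 0 \<Longrightarrow> wp n c1 s Q" and "val b s = 0 \<Longrightarrow> wp n c2 s Q"
  shows "wp n (If b c1 c2) s Q"
proof (cases "val b s = 0")
  case True
  then obtain t s' where "exec (n ^ 20) c2 s t s'" "t \<le> time_bound n c2" "bounded n s'" "Q s'"
    using assms(5) unfolding wp_def by blast
  moreover from exec.IfFalse[OF fits_if_degree[OF assms(1-3)] True this(1)]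
  have "exec (n ^ 20) (If b c1 c2) s (1 + cost b + t) s'" .
  ultimately show ?thesis unfolding wp_def by fastforce
next
  case False
  then obtain t s' where "exec (n ^ 20) c1 s t s'" "t \<le> time_bound n c1" "bounded n s'" "Q s'"
    using assms(4) unfolding wp_def by blast
  moreover from exec.IfTrue[OF fits_if_degree[OF assms(1-3)] False this(1)]
  have "exec (n ^ 20) (If b c1 c2) s (1 + cost b + t) s'" .
  ultimately show ?thesis unfolding wp_def by fastforce
qed

text \<open>\<open>J\<close> is indexed by the iteration number and the guard holds exactly below
  \<open>n\<close>, so there are \<open>n\<close> iterations, as \<open>time_bound\<close>
  charges.\<close>

lemma wp_While:
  assumes n: "2 \<le> n" and b: "fits_degree b \<le> 20"
    and init: "bounded n s" "J 0 s"
    and guard: "\<And>k s. k \<le> n \<Longrightarrow> J k s \<Longrightarrow> val b s \<noteq> 0 \<longleftrightarrow> k < n"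
    and step: "\<And>k s. k < n \<Longrightarrow> J k s \<Longrightarrow> bounded n s \<Longrightarrow> wp n c s (J (Suc k))"
  shows "wp n (While b c) s (J n)"
proof -
  let ?T = "1 + cost b + time_bound n c"
  \<comment> \<open>Generalised to a run entered at iteration \<open>k\<close>, with time for the
    remaining \<open>n - k\<close> iterations only.\<close>
  have "\<exists>t s'. exec (n ^ 20) (While b c) s t s' \<and> t \<le> 1 + cost b + (n - k) * ?T \<and> bounded n s' \<and> J n s'"
    if "k \<le> n" "J k s" "bounded n s" for k s
    using that
  proof (induction "n - k" arbitrary: k s)
    case 0
    then have "val b s = 0" using guard[of k s] by simp
    then show ?case using 0 exec.WhileFalse[OF fits_if_degree[OF n \<open>bounded n s\<close> b]] by fastforce
  next
    case (Suc m)
    then have "k < n" by simp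
    obtain t1 s1 where 1: "exec (n ^ 20) c s t1 s1" "t1 \<le> time_bound n c" "bounded n s1" "J (Suc k) s1"
      using step[OF \<open>k < n\<close> Suc.prems(2,3)] unfolding wp_def by blast
    have "m = n - Suc k" using Suc.hyps(2) by simp
    from Suc.hyps(1)[OF this _ 1(4,3)] \<open>k < n\<close> obtain t2 s2 where 2:
      "exec (n ^ 20) (While b c) s1 t2 s2" "t2 \<le> 1 + cost b + (n - Suc k) * ?T" "bounded n s2" "J n s2"
      by auto
    have "val b s \<noteq> 0" using guard[of k s] \<open>k < n\<close> Suc.prems by simp
    from exec.WhileTrue[OF fits_if_degree[OF n Suc.prems(3) b] this 1(1) 2(1)]
    have "exec (n ^ 20) (While b c) s (1 + cost b + t1 + t2) s2" .
    moreover have "(n - k) * ?T = ?T + (n - Suc k) * ?T"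
      using \<open>k < n\<close> by (metis Suc_diff_Suc mult_Suc)
    ultimately show ?case using 1(2) 2 by (intro exI[of _ "1 + cost b + t1 + t2"] exI[of _ s2]) linarith
  qed
  from this[of 0 s] init show ?thesis unfolding wp_def by simp
qed

abbreviation Var :: "vname \<Rightarrow> expr" where
  "Var x \<equiv> Read x (Const 0)"

abbreviation Assign :: "vname \<Rightarrow> expr \<Rightarrow> com" where
  "Assign x e \<equiv> Write x (Const 0) e"

definition For :: "vname \<Rightarrow> com \<Rightarrow> com" where
  "For i c = Seq (Assign i (Const 0))
     (While (Bin Less (Var i) (Var ''n'')) (Seq c (Assign i (Bin Add (Var i) (Const 1)))))"

lemma writes_For [simp]: "writes (For i c) = insert i (writes c)"
  by (auto simp: For_def)

lemma loop_depth_For [simp]: "loop_depth (For i c) = Suc (loop_depth c)"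
  by (simp add: For_def)

text \<open>The increment at the end of the body is handled by the rule: the step obligation runs
  only \<open>c\<close> and asks for \<open>I\<close> in the state with the counter already
  advanced.\<close>

lemma wp_For:
  assumes n: "2 \<le> n" and s: "bounded n s" "s ''n'' 0 = n"
    and i: "''n'' \<noteq> i" "i \<notin> writes c" "''n'' \<notin> writes c"
    and init: "I 0 (s(i := (s i)(0 := 0)))"
    and step: "\<And>k s'. k < n \<Longrightarrow> I k s' \<Longrightarrow> bounded n s' \<Longrightarrow> s' i 0 = k \<Longrightarrow>
      (\<And>x. x \<notin> insert i (writes c) \<Longrightarrow> s' x = s x) \<Longrightarrow>
      wp n c s' (\<lambda>s''. I (Suc k) (s''(i := (s'' i)(0 := Suc k))))"
    and final: "\<And>s'. I n s' \<Longrightarrow> bounded n s' \<Longrightarrow>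
      (\<And>x. x \<notin> insert i (writes c) \<Longrightarrow> s' x = s x) \<Longrightarrow> Q s'"
  shows "wp n (For i c) s Q"
  unfolding For_def
proof (rule wp_Seq)
  let ?s0 = "s(i := (s i)(0 := 0))"
  let ?b = "Bin Less (Var i) (Var ''n'')" and ?c = "Seq c (Assign i (Bin Add (Var i) (Const 1)))"
  define J where "J k s' \<longleftrightarrow> I k s' \<and> s' i 0 = k \<and> (\<forall>x. x \<notin> insert i (writes c) \<longrightarrow> s' x = s x)" for k s'
  show "wp n (Assign i (Const 0)) s (\<lambda>s'. s' = ?s0)"
    using n s by (intro wp_Write) simp_all
  fix s' assume bd: "bounded n s'" and "s' = ?s0"
  then have J0: "J 0 s'" using init by (auto simp: J_def)
  have Jn: "s' ''n'' 0 = n" if "J k s'" for k s' using that s(2) i unfolding J_def by auto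
  have "wp n (While ?b ?c) s' (J n)"
  proof (rule wp_While)
    fix k s' assume kn: "k < n" and J: "J k s'" and bd: "bounded n s'"
    have "wp n c s' (\<lambda>s''. I (Suc k) (s''(i := (s'' i)(0 := Suc k))))"
      by (rule step) (use J kn bd in \<open>auto simp: J_def\<close>)
    then show "wp n ?c s' (J (Suc k))"
    proof (rule wp_Seq)
      fix s'' assume *: "bounded n s''" "\<And>x. x \<notin> writes c \<Longrightarrow> s'' x = s' x"
        "I (Suc k) (s''(i := (s'' i)(0 := Suc k)))"
      then show "wp n (Assign i (Bin Add (Var i) (Const 1))) s'' (J (Suc k))"
        using n kn J i by (intro wp_Write) (auto simp: J_def)
    qed
  qed (use n bd J0 Jn in \<open>auto simp: J_def split: if_splits\<close>)
  then show "wp n (While ?b ?c) s' Q"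
    by (rule wp_mono) (use final in \<open>auto simp: J_def\<close>)
qed

section \<open>The program\<close>

text \<open>
  Truth values are stored as 0 and 1. The array \<open>D\<close> marks the vertices whose rows of \<open>H\<close> are final and
  \<open>I\<close> those reached in the current attempt, which are also listed in \<open>Q\<close>, with \<open>t\<close> their number. An
  attempt starts from the pair \<open>p\<close>, \<open>w\<close> with common neighbour \<open>z\<close>, and \<open>o\<close> says which of the two cliques
  is taken. The flag \<open>k\<close> is the result of the check, and \<open>c\<close> counts common neighbours in \<open>H\<close>.
\<close>

abbreviation Entry :: "vname \<Rightarrow> vname \<Rightarrow> vname \<Rightarrow> expr" where
  "Entry A u v \<equiv> Read A (Bin Add (Bin Mul (Var u) (Var ''n'')) (Var v))"

abbreviation Cell :: "vname \<Rightarrow> vname \<Rightarrow> expr" where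
  "Cell A v \<equiv> Read A (Var v)"

abbreviation Complement :: "expr \<Rightarrow> expr" where
  "Complement e \<equiv> Bin Sub (Const 1) e"

definition fill_row :: "vname \<Rightarrow> vname \<Rightarrow> expr \<Rightarrow> com" where
  "fill_row r i e = For i (Write ''H'' (Bin Add (Bin Mul (Var r) (Var ''n'')) (Var i)) e)"

definition clear :: com where
  "clear = For ''v'' (Write ''I'' (Var ''v'') (Const 0))"

text \<open>Arithmetic form of \<open>root_row\<close>: products are conjunctions and
  \<open>0 <\<close> a sum is a disjunction. \<open>v = z\<close> and \<open>g z v\<close> exclude
  each other, so their sum is itself a truth value that can be compared with
  \<open>o\<close>.\<close>

definition first_row :: com where
  "first_row = fill_row ''p'' ''v''
     (Bin Mul (Entry ''G'' ''p'' ''v'')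
       (Bin Less (Const 0) (Bin Add (Bin Equal (Var ''v'') (Var ''w''))
         (Bin Mul (Entry ''G'' ''w'' ''v'')
           (Bin Equal (Bin Add (Bin Equal (Var ''v'') (Var ''z'')) (Entry ''G'' ''z'' ''v'')) (Var ''o''))))))"

text \<open>The right side of \<open>good_next_row\<close>. A sum suffices for the disjunction
  because its alternatives exclude each other.\<close>

definition next_row :: com where
  "next_row = fill_row ''v'' ''a''
     (Bin Add (Bin Equal (Var ''a'') (Var ''u''))
       (Bin Mul (Bin Mul (Entry ''G'' ''u'' ''a'') (Entry ''G'' ''v'' ''a'')) (Complement (Entry ''H'' ''u'' ''a''))))"

definition start :: com where
  "start = Seq (Write ''I'' (Var ''p'') (Const 1))
     (Seq (Write ''Q'' (Const 0) (Var ''p'')) (Assign ''t'' (Const 1)))"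

text \<open>Vertices marked in \<open>D\<close> are passed over, so final rows are never
  overwritten.\<close>

definition visit :: com where
  "visit = If (Bin Mul (Entry ''H'' ''u'' ''v'') (Bin Mul (Complement (Cell ''I'' ''v'')) (Complement (Cell ''D'' ''v''))))
     (Seq next_row (Seq (Write ''I'' (Var ''v'') (Const 1))
       (Seq (Write ''Q'' (Var ''t'') (Var ''v'')) (Assign ''t'' (Bin Add (Var ''t'') (Const 1))))))
     Skip"

text \<open>Breadth-first search driven by a counting loop over all \<open>n\<close> possible queue
  positions, those beyond the end of the queue being skipped. The number of iterations is thus fixed
  in advance.\<close>

definition propagate :: com where
  "propagate = For ''j'' (If (Bin Less (Var ''j'') (Var ''t''))
     (Seq (Assign ''u'' (Cell ''Q'' ''j'')) (For ''v'' visit)) Skip)"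

definition triple_condition :: expr where
  "triple_condition = Complement (Bin Mul (Entry ''H'' ''u'' ''v'')
     (Bin Mul (Bin Mul (Entry ''G'' ''u'' ''a'') (Entry ''G'' ''v'' ''a''))
       (Bin Mul (Complement (Entry ''H'' ''u'' ''a'')) (Complement (Entry ''H'' ''v'' ''a'')))))"

definition check_triple :: com where
  "check_triple = Seq (Assign ''c'' (Bin Add (Var ''c'') (Bin Mul (Entry ''H'' ''u'' ''a'') (Entry ''H'' ''a'' ''v''))))
     (Assign ''k'' (Bin Mul (Var ''k'') triple_condition))"

text \<open>An implication is coded as the complement of the premise times the complement of the
  conclusion. The 5-cycle clause is left to \<open>triple_condition\<close>.\<close>

definition pair_condition :: expr where
  "pair_condition = Bin Mul
     (Complement (Bin Mul (Entry ''H'' ''u'' ''v'') (Complement (Bin Mul (Cell ''I'' ''v'')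
       (Bin Mul (Entry ''H'' ''v'' ''u'') (Complement (Bin Equal (Var ''u'') (Var ''v''))))))))
     (Bin Mul
       (Complement (Bin Mul (Complement (Bin Equal (Var ''u'') (Var ''v'')))
         (Complement (Bin Equal (Entry ''G'' ''u'' ''v'') (Bin Add (Entry ''H'' ''u'' ''v'') (Var ''c''))))))
       (Complement (Bin Mul (Bin Mul (Bin Equal (Var ''u'') (Var ''x'')) (Bin Equal (Var ''v'') (Var ''y'')))
         (Complement (Entry ''H'' ''u'' ''v'')))))"

definition check_pair :: com where
  "check_pair = Seq (Assign ''c'' (Const 0)) (Seq (For ''a'' check_triple)
     (Assign ''k'' (Bin Mul (Var ''k'') pair_condition)))"

definition check :: com where
  "check = Seq (Assign ''k'' (Const 1))
     (For ''u'' (If (Cell ''I'' ''u'') (For ''v'' check_pair) Skip))"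

definition commit :: com where
  "commit = For ''v'' (Write ''D'' (Var ''v'')
     (Bin Less (Const 0) (Bin Add (Cell ''D'' ''v'') (Bin Mul (Var ''k'') (Cell ''I'' ''v'')))))"

definition attempt :: com where
  "attempt = Seq clear (Seq first_row (Seq start (Seq propagate (Seq check commit))))"

text \<open>A guess for a \<open>p\<close> already marked would overwrite a final row.\<close>

definition attempt_if :: "nat \<Rightarrow> com" where
  "attempt_if b = If (Cell ''D'' ''p'') Skip (Seq (Assign ''o'' (Const b)) attempt)"

definition find_least :: com where
  "find_least = Seq (Assign ''p'' (Var ''w''))
     (For ''v'' (If (Bin Mul (Entry ''G'' ''w'' ''v'') (Bin Less (Var ''v'') (Var ''p'')))
       (Assign ''p'' (Var ''v'')) Skip))"

definition find_common :: com where
  "find_common = Seq (Assign ''z'' (Const 0))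
     (For ''v'' (If (Bin Mul (Entry ''G'' ''p'' ''v'') (Entry ''G'' ''w'' ''v''))
       (Assign ''z'' (Var ''v'')) Skip))"

definition search :: com where
  "search = For ''w'' (Seq find_least (Seq find_common (Seq (attempt_if 0) (attempt_if 1))))"

definition decide :: com where
  "decide = Seq (Assign ''answer'' (Const 1))
     (For ''v'' (Assign ''answer'' (Bin Mul (Var ''answer'') (Cell ''D'' ''v''))))"

definition root_program :: com where
  "root_program = Seq search decide"

lemmas program_defs = fill_row_def clear_def first_row_def next_row_def start_def visit_def
  propagate_def check_triple_def check_pair_def check_def commit_def attempt_def attempt_if_def
  find_least_def find_common_def search_def decide_def root_program_def

text \<open>A linear number of pairs, each with a cubic attempt.\<close>

lemma loop_depth_root_program: "loop_depth root_program = 4"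
  by (simp add: program_defs)

lemma writes_fill_row [simp]: "writes (fill_row r i e) = {i, ''H''}"
  by (simp add: fill_row_def)

lemma writes_clear [simp]: "writes clear = {''v'', ''I''}"
  by (simp add: clear_def)

lemma writes_first_row [simp]: "writes first_row = {''v'', ''H''}"
  by (simp add: first_row_def)

lemma writes_next_row [simp]: "writes next_row = {''a'', ''H''}"
  by (simp add: next_row_def)

lemma writes_start [simp]: "writes start = {''I'', ''Q'', ''t''}"
  by (auto simp: start_def)

lemma writes_visit [simp]: "writes visit = {''a'', ''H'', ''I'', ''Q'', ''t''}"
  by (auto simp: visit_def)

lemma writes_propagate [simp]: "writes propagate = {''j'', ''u'', ''v'', ''a'', ''H'', ''I'', ''Q'', ''t''}"
  by (auto simp: propagate_def)

lemma writes_check_triple [simp]: "writes check_triple = {''c'', ''k''}"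
  by (auto simp: check_triple_def)

lemma writes_check_pair [simp]: "writes check_pair = {''a'', ''c'', ''k''}"
  by (auto simp: check_pair_def)

lemma writes_check [simp]: "writes check = {''u'', ''v'', ''a'', ''c'', ''k''}"
  by (auto simp: check_def)

lemma writes_commit [simp]: "writes commit = {''v'', ''D''}"
  by (simp add: commit_def)

lemma writes_attempt [simp]:
  "writes attempt = {''j'', ''u'', ''v'', ''a'', ''c'', ''k'', ''t'', ''D'', ''H'', ''I'', ''Q''}"
  by (auto simp: attempt_def)

lemma writes_attempt_if [simp]: "writes (attempt_if b) = insert ''o'' (writes attempt)"
  by (auto simp: attempt_if_def)

lemma writes_find_least [simp]: "writes find_least = {''p'', ''v''}"
  by (auto simp: find_least_def)

lemma writes_find_common [simp]: "writes find_common = {''v'', ''z''}"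
  by (auto simp: find_common_def)

lemma cell_index_inj:
  assumes "u * n + v = u' * n + v'" "v < n" "v' < (n::nat)"
  shows "u = u' \<and> v = v'"
proof -
  have "(a * n + b) div n = a" if "b < n" for a b using that by simp
  from this[OF assms(2), of u] this[OF assms(3), of u'] have "u = u'" using assms(1) by simp
  with assms(1) show ?thesis by simp
qed

section \<open>Correctness of the program\<close>

lemma card_less_Suc_Collect:
  "card {z. z < Suc a \<and> P z} = card {z. z < a \<and> P z} + of_bool (P a)"
proof (cases "P a")
  case True
  then have "{z. z < Suc a \<and> P z} = insert a {z. z < a \<and> P z}" by (auto simp: less_Suc_eq)
  with True show ?thesis by simp
next
  case False
  then have "{z. z < Suc a \<and> P z} = {z. z < a \<and> P z}" by (auto simp: less_Suc_eq)
  with False show ?thesis by simp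
qed

lemma card_less_Collect_le: "card {z. z < a \<and> P z} \<le> (a::nat)"
  using card_mono[of "{..<a}" "{z. z < a \<and> P z}"] by auto

text \<open>Evaluates \<open>pair_condition\<close> times the running flag \<open>b\<close>:
  \<open>h\<close> and \<open>h'\<close> are the two entries of the pair in the root,
  \<open>i\<close> is the mark of \<open>v\<close> in \<open>I\<close>, and \<open>l\<close>,
  \<open>r\<close> are the sides of the count.\<close>

lemma check_value:
  "of_bool b * ((1 - of_bool h * (1 - of_bool i * (of_bool h' * (1 - (if u = v then 1 else 0))))) *
    ((1 - (1 - (if u = v then 1 else 0)) * (1 - (if l = r then 1 else 0))) *
      (1 - (if u = x then 1 else 0) * (if v = y then 1 else 0) * (1 - of_bool h)))) =
   (of_bool (b \<and> (h \<longrightarrow> i \<and> h' \<and> u \<noteq> v) \<and> (u \<noteq> v \<longrightarrow> l = r) \<and> (u = x \<and> v = y \<longrightarrow> h)) :: nat)"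
  by (cases b; cases h; cases i; cases h'; simp)

section \<open>Reading memory as graph data and filling rows\<close>

context square_instance begin

definition instance_in :: "state \<Rightarrow> bool" where
  "instance_in s \<longleftrightarrow> s ''n'' 0 = n \<and> s ''x'' 0 = x \<and> s ''y'' 0 = y \<and>
     (\<forall>u<n. \<forall>v<n. s ''G'' (u * n + v) = of_bool (g u v))"

definition rel :: "state \<Rightarrow> nat \<Rightarrow> nat \<Rightarrow> bool" where
  "rel s u v \<longleftrightarrow> s ''H'' (u * n + v) = 1"

definition members :: "vname \<Rightarrow> state \<Rightarrow> nat set" where
  "members A s = {v. v < n \<and> s A v = 1}"

definition binary :: "vname \<Rightarrow> state \<Rightarrow> bool" where
  "binary A s \<longleftrightarrow> (\<forall>v<n. s A v \<le> 1)"

definition binary_H :: "state \<Rightarrow> bool" where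
  "binary_H s \<longleftrightarrow> (\<forall>u<n. \<forall>v<n. s ''H'' (u * n + v) \<le> 1)"

lemma instance_inD:
  "instance_in s \<Longrightarrow> s ''n'' 0 = n" "instance_in s \<Longrightarrow> s ''x'' 0 = x" "instance_in s \<Longrightarrow> s ''y'' 0 = y"
  "instance_in s \<Longrightarrow> u < n \<Longrightarrow> v < n \<Longrightarrow> s ''G'' (u * n + v) = of_bool (g u v)"
  by (auto simp: instance_in_def)

lemma instance_in_cong:
  assumes "instance_in s" "s' ''n'' = s ''n''" "s' ''x'' = s ''x''" "s' ''y'' = s ''y''" "s' ''G'' = s ''G''"
  shows "instance_in s'"
  using assms by (simp add: instance_in_def)

lemma rel_cong: "s' ''H'' = s ''H'' \<Longrightarrow> rel s' = rel s"
  by (simp add: rel_def fun_eq_iff)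

lemma members_cong: "s' A = s A \<Longrightarrow> members A s' = members A s"
  by (simp add: members_def)

lemma binary_cong: "s' A = s A \<Longrightarrow> binary A s' = binary A s"
  by (simp add: binary_def)

lemma binary_H_cong: "s' ''H'' = s ''H'' \<Longrightarrow> binary_H s' = binary_H s"
  by (simp add: binary_H_def)

lemma H_of_bool: "binary_H s \<Longrightarrow> u < n \<Longrightarrow> v < n \<Longrightarrow> s ''H'' (u * n + v) = of_bool (rel s u v)"
proof -
  assume "binary_H s" "u < n" "v < n"
  then have "s ''H'' (u * n + v) \<le> 1" unfolding binary_H_def by blast
  then consider "s ''H'' (u * n + v) = 0" | "s ''H'' (u * n + v) = 1" by linarith
  then show ?thesis by cases (simp_all add: rel_def)
qed

lemma cell_of_bool: "binary A s \<Longrightarrow> v < n \<Longrightarrow> s A v = of_bool (v \<in> members A s)"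
  unfolding binary_def members_def by (cases "s A v = 0") (auto simp: le_Suc_eq)

text \<open>The expression may itself read \<open>H\<close>, but only in rows other than the one
  being written; the premise \<open>val\<close> therefore offers that those rows are
  unchanged.\<close>

lemma wp_fill_row:
  assumes s: "bounded n s" "s ''n'' 0 = n" and r: "s r 0 < n"
    and i: "i \<noteq> ''n''" "i \<noteq> ''H''" "i \<noteq> r" "r \<noteq> ''H''"
    and e: "fits_degree e \<le> 20"
    and val: "\<And>s' v. v < n \<Longrightarrow> (\<And>x. x \<noteq> i \<Longrightarrow> x \<noteq> ''H'' \<Longrightarrow> s' x = s x) \<Longrightarrow> s' i 0 = v \<Longrightarrow>
      (\<And>u v. u < n \<Longrightarrow> v < n \<Longrightarrow> u \<noteq> s r 0 \<Longrightarrow> s' ''H'' (u * n + v) = s ''H'' (u * n + v)) \<Longrightarrow>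
      val e s' = of_bool (f v)"
    and final: "\<And>s'. bounded n s' \<Longrightarrow> (\<And>x. x \<noteq> i \<Longrightarrow> x \<noteq> ''H'' \<Longrightarrow> s' x = s x) \<Longrightarrow>
      (\<And>v. v < n \<Longrightarrow> s' ''H'' (s r 0 * n + v) = of_bool (f v)) \<Longrightarrow>
      (\<And>u v. u < n \<Longrightarrow> v < n \<Longrightarrow> u \<noteq> s r 0 \<Longrightarrow> s' ''H'' (u * n + v) = s ''H'' (u * n + v)) \<Longrightarrow> Q s'"
  shows "wp n (fill_row r i e) s Q"
  unfolding fill_row_def
proof -
  let ?c = "Write ''H'' (Bin Add (Bin Mul (Var r) (Var ''n'')) (Var i)) e"
  let ?I = "\<lambda>k s'. (\<forall>v<k. s' ''H'' (s r 0 * n + v) = of_bool (f v)) \<and>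
    (\<forall>u v. u < n \<longrightarrow> v < n \<longrightarrow> u \<noteq> s r 0 \<longrightarrow> s' ''H'' (u * n + v) = s ''H'' (u * n + v))"
  show "wp n (For i ?c) s Q"
  proof (rule wp_For[OF two_le_n s, where I = ?I])
    fix k s'
    assume k: "k < n" and I: "?I k s'" and bd: "bounded n s'" "s' i 0 = k"
      and "\<And>x. x \<notin> insert i (writes ?c) \<Longrightarrow> s' x = s x"
    then have frame: "s' x = s x" if "x \<noteq> i" "x \<noteq> ''H''" for x using that by simp
    have v: "val e s' = of_bool (f k)" by (rule val[OF k frame]) (use bd I in auto)
    have idx: "val (Bin Add (Bin Mul (Var r) (Var ''n'')) (Var i)) s' = s r 0 * n + k"
      using frame[of r] frame[of "''n''"] i bd s by simp
    have other: "u * n + w \<noteq> s r 0 * n + k" if "u \<noteq> s r 0" "w < n" for u w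
      using cell_index_inj[of u n w "s r 0" k] that k by blast
    show "wp n ?c s' (\<lambda>s''. ?I (Suc k) (s''(i := (s'' i)(0 := Suc k))))"
    proof (rule wp_Write[OF two_le_n bd(1) _ e])
      show "val e s' \<le> n" unfolding v using two_le_n by simp
      show "?I (Suc k) ((s'(''H'' := (s' ''H'')(val (Bin Add (Bin Mul (Var r) (Var ''n'')) (Var i)) s' := val e s')))
          (i := ((s'(''H'' := (s' ''H'')(val (Bin Add (Bin Mul (Var r) (Var ''n'')) (Var i)) s' := val e s'))) i)
            (0 := Suc k)))"
        unfolding idx v using I i other by (simp add: less_Suc_eq)
    qed simp
  next
    fix s' assume "?I n s'" "bounded n s'" and "\<And>x. x \<notin> insert i (writes ?c) \<Longrightarrow> s' x = s x"
    then show "Q s'" by (intro final) simp_all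
  qed (use i in simp_all)
qed

lemma wp_clear:
  assumes "bounded n s" "s ''n'' 0 = n"
  shows "wp n clear s (\<lambda>s'. \<forall>v<n. s' ''I'' v = 0)"
  unfolding clear_def
proof (rule wp_For[OF two_le_n assms, where I = "\<lambda>k s'. \<forall>v<k. s' ''I'' v = 0"])
  fix k s' assume "k < n" "\<forall>v<k. s' ''I'' v = 0" "bounded n s'" "s' ''v'' 0 = k"
  then show "wp n (Write ''I'' (Var ''v'') (Const 0)) s'
      (\<lambda>s''. \<forall>v<Suc k. (s''(''v'' := (s'' ''v'')(0 := Suc k))) ''I'' v = 0)"
    using two_le_n by (intro wp_Write) (auto simp: less_Suc_eq)
qed simp_all

lemma wp_first_row:
  assumes s: "instance_in s" "bounded n s" "binary_H s"
    and p: "s ''p'' 0 = p" "p < n" and w: "s ''w'' 0 = w" "w < n" and z: "s ''z'' 0 = z" "z < n"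
    and b: "s ''o'' 0 = of_bool b"
  shows "wp n first_row s (\<lambda>s'. binary_H s' \<and> (\<forall>v<n. rel s' p v = root_row p w z b v) \<and>
    (\<forall>u v. u < n \<longrightarrow> v < n \<longrightarrow> u \<noteq> p \<longrightarrow> s' ''H'' (u * n + v) = s ''H'' (u * n + v)))"
  unfolding first_row_def
proof (rule wp_fill_row[where f = "root_row p w z b"])
  fix s' v
  assume v: "v < n" "s' ''v'' 0 = v"
    and frame: "\<And>x. x \<noteq> ''v'' \<Longrightarrow> x \<noteq> ''H'' \<Longrightarrow> s' x = s x"
  note G = instance_inD(1)[OF s(1)] instance_inD(4)[OF s(1)]
  have "of_bool (v = z) + of_bool (g z v) = (of_bool (v = z \<or> g z v) :: nat)"
    using g_irrefl by auto
  then show "val (Bin Mul (Entry ''G'' ''p'' ''v'')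
       (Bin Less (Const 0) (Bin Add (Bin Equal (Var ''v'') (Var ''w''))
         (Bin Mul (Entry ''G'' ''w'' ''v'')
           (Bin Equal (Bin Add (Bin Equal (Var ''v'') (Var ''z'')) (Entry ''G'' ''z'' ''v'')) (Var ''o'')))))) s'
      = of_bool (root_row p w z b v)"
    using v p w z b by (auto simp: frame G root_row_def)
next
  fix s'
  assume row: "\<And>v. v < n \<Longrightarrow> s' ''H'' (s ''p'' 0 * n + v) = of_bool (root_row p w z b v)"
    and other: "\<And>u v. u < n \<Longrightarrow> v < n \<Longrightarrow> u \<noteq> s ''p'' 0 \<Longrightarrow> s' ''H'' (u * n + v) = s ''H'' (u * n + v)"
  have "s' ''H'' (u * n + v) \<le> 1" if "u < n" "v < n" for u v
    using row[of v] other[of u v] s(3) that p unfolding binary_H_def by (cases "u = p") auto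
  then show "binary_H s' \<and> (\<forall>v<n. rel s' p v = root_row p w z b v) \<and>
    (\<forall>u v. u < n \<longrightarrow> v < n \<longrightarrow> u \<noteq> p \<longrightarrow> s' ''H'' (u * n + v) = s ''H'' (u * n + v))"
    using row other p by (simp add: binary_H_def rel_def)
qed (use s p instance_inD in simp_all)

lemma wp_next_row:
  assumes s: "instance_in s" "bounded n s" "binary_H s"
    and u: "s ''u'' 0 = u" "u < n" and v: "s ''v'' 0 = v" "v < n" and uv: "u \<noteq> v"
  shows "wp n next_row s (\<lambda>s'. binary_H s' \<and>
    (\<forall>a<n. rel s' v a = (a = u \<or> g u a \<and> g v a \<and> \<not> rel s u a)) \<and>
    (\<forall>a b. a < n \<longrightarrow> b < n \<longrightarrow> a \<noteq> v \<longrightarrow> s' ''H'' (a * n + b) = s ''H'' (a * n + b)))"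
  unfolding next_row_def
proof (rule wp_fill_row[where f = "\<lambda>a. a = u \<or> g u a \<and> g v a \<and> \<not> rel s u a"])
  fix s' a
  assume a: "a < n" "s' ''a'' 0 = a"
    and frame: "\<And>x. x \<noteq> ''a'' \<Longrightarrow> x \<noteq> ''H'' \<Longrightarrow> s' x = s x"
    and other: "\<And>a b. a < n \<Longrightarrow> b < n \<Longrightarrow> a \<noteq> s ''v'' 0 \<Longrightarrow> s' ''H'' (a * n + b) = s ''H'' (a * n + b)"
  note G = instance_inD(1)[OF s(1)] instance_inD(4)[OF s(1)]
  \<comment> \<open>\<open>u \<noteq> v\<close> keeps the row that is read apart from the row being
    written.\<close>
  have H: "s' ''H'' (u * n + a) = of_bool (rel s u a)"
    using other[of u a] a u v uv H_of_bool[OF s(3), of u a] by simp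
  show "val (Bin Add (Bin Equal (Var ''a'') (Var ''u''))
       (Bin Mul (Bin Mul (Entry ''G'' ''u'' ''a'') (Entry ''G'' ''v'' ''a'')) (Complement (Entry ''H'' ''u'' ''a'')))) s'
      = of_bool (a = u \<or> g u a \<and> g v a \<and> \<not> rel s u a)"
    using a u v H g_irrefl[of u] by (auto simp: frame G)
next
  fix s'
  assume row: "\<And>a. a < n \<Longrightarrow> s' ''H'' (s ''v'' 0 * n + a) = of_bool (a = u \<or> g u a \<and> g v a \<and> \<not> rel s u a)"
    and other: "\<And>a b. a < n \<Longrightarrow> b < n \<Longrightarrow> a \<noteq> s ''v'' 0 \<Longrightarrow> s' ''H'' (a * n + b) = s ''H'' (a * n + b)"
  have "s' ''H'' (a * n + b) \<le> 1" if "a < n" "b < n" for a b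
    using row[of b] other[of a b] s(3) that v unfolding binary_H_def by (cases "a = v") auto
  then show "binary_H s' \<and>
    (\<forall>a<n. rel s' v a = (a = u \<or> g u a \<and> g v a \<and> \<not> rel s u a)) \<and>
    (\<forall>a b. a < n \<longrightarrow> b < n \<longrightarrow> a \<noteq> v \<longrightarrow> s' ''H'' (a * n + b) = s ''H'' (a * n + b))"
    using row other v by (simp add: binary_H_def rel_def)
qed (use s v instance_inD in simp_all)

section \<open>The queue and the spreading of rows along edges\<close>

definition queue :: "state \<Rightarrow> nat list \<Rightarrow> bool" where
  "queue s q \<longleftrightarrow> s ''t'' 0 = length q \<and> (\<forall>i<length q. s ''Q'' i = q ! i) \<and>
     (\<forall>v<n. s ''I'' v = of_bool (v \<in> set q)) \<and> distinct q \<and> set q \<subseteq> {..<n}"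

text \<open>Distinct entries keep the queue within \<open>n\<close> places, so \<open>t\<close>
  stays bounded and \<open>n\<close> rounds of the loop reach every entry.\<close>

lemma queue_length: "distinct q \<Longrightarrow> set q \<subseteq> {..<n} \<Longrightarrow> length q \<le> n"
  using card_mono[of "{..<n}" "set q"] by (simp add: distinct_card)

lemma queue_cong:
  "queue s q \<Longrightarrow> s' ''t'' = s ''t'' \<Longrightarrow> s' ''Q'' = s ''Q'' \<Longrightarrow> s' ''I'' = s ''I'' \<Longrightarrow> queue s' q"
  by (simp add: queue_def)

text \<open>\<open>r\<close> is the part appended by the visit, empty or just \<open>v\<close>.
  Stating the effect as an extension of \<open>q\<close> lets successive visits be chained.\<close>

lemma wp_visit:
  assumes s: "instance_in s" "bounded n s" "binary_H s" "binary ''D'' s" and q: "queue s q"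
    and u: "s ''u'' 0 = u" "u \<in> set q" and v: "s ''v'' 0 = v" "v < n"
  shows "wp n visit s (\<lambda>s'. binary_H s' \<and> (\<exists>r. queue s' (q @ r) \<and>
    (\<forall>a b. a < n \<longrightarrow> b < n \<longrightarrow> a \<notin> set r \<longrightarrow> s' ''H'' (a * n + b) = s ''H'' (a * n + b)) \<and>
    (rel s u v \<longrightarrow> v \<in> set (q @ r) \<union> members ''D'' s) \<and>
    (r = [] \<or> r = [v] \<and> rel s u v \<and> v \<notin> members ''D'' s \<and>
      (\<forall>a<n. rel s' v a = (a = u \<or> g u a \<and> g v a \<and> \<not> rel s u a)))))"
  (is "wp n visit s (\<lambda>s'. binary_H s' \<and> (\<exists>r. ?P s' r))")
proof -
  have un: "u < n" using q u by (auto simp: queue_def)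
  have val: "val (Bin Mul (Entry ''H'' ''u'' ''v'') (Bin Mul (Complement (Cell ''I'' ''v'')) (Complement (Cell ''D'' ''v'')))) s
    = of_bool (rel s u v \<and> v \<notin> set q \<and> v \<notin> members ''D'' s)"
    using q u v un s H_of_bool[OF s(3) un v(2)] cell_of_bool[OF s(4) v(2)]
    by (auto simp: queue_def instance_inD)
  show ?thesis
    unfolding visit_def
  proof (rule wp_If[OF two_le_n s(2)])
    assume "val (Bin Mul (Entry ''H'' ''u'' ''v'')
      (Bin Mul (Complement (Cell ''I'' ''v'')) (Complement (Cell ''D'' ''v'')))) s \<noteq> 0"
    then have new: "rel s u v" "v \<notin> set q" "v \<notin> members ''D'' s" unfolding val by simp_all
    then have "u \<noteq> v" using u by blast
    have qv: "distinct (q @ [v])" "set (q @ [v]) \<subseteq> {..<n}" using q new v by (auto simp: queue_def)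
    have len: "length q < n" using queue_length[OF qv] by simp
    show "wp n (Seq next_row (Seq (Write ''I'' (Var ''v'') (Const 1))
       (Seq (Write ''Q'' (Var ''t'') (Var ''v'')) (Assign ''t'' (Bin Add (Var ''t'') (Const 1))))))
       s (\<lambda>s'. binary_H s' \<and> (\<exists>r. ?P s' r))"
    proof (rule wp_Seq[OF wp_next_row[OF s(1-3) u(1) un v \<open>u \<noteq> v\<close>]])
      fix s1 assume s1: "bounded n s1" "\<And>x. x \<notin> writes next_row \<Longrightarrow> s1 x = s x"
        and *: "binary_H s1 \<and> (\<forall>a<n. rel s1 v a = (a = u \<or> g u a \<and> g v a \<and> \<not> rel s u a)) \<and>
         (\<forall>a b. a < n \<longrightarrow> b < n \<longrightarrow> a \<noteq> v \<longrightarrow> s1 ''H'' (a * n + b) = s ''H'' (a * n + b))"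
      have frame: "s1 ''I'' = s ''I''" "s1 ''Q'' = s ''Q''" "s1 ''t'' = s ''t''" "s1 ''v'' = s ''v''"
        using s1(2) by simp_all
      define s2 where "s2 = s1(''I'' := (s1 ''I'')(v := 1))"
      define s3 where "s3 = s2(''Q'' := (s2 ''Q'')(length q := v))"
      define s4 where "s4 = s3(''t'' := (s3 ''t'')(0 := Suc (length q)))"
      have t: "s ''t'' 0 = length q" using q by (simp add: queue_def)
      have b2: "bounded n s2" using s1(1) two_le_n by (simp add: s2_def bounded_def)
      have b3: "bounded n s3" using b2 v by (simp add: s3_def bounded_def)
      have H4: "s4 ''H'' = s1 ''H''" by (simp add: s4_def s3_def s2_def)
      have "queue s4 (q @ [v])"
        using q qv frame by (auto simp: queue_def s4_def s3_def s2_def nth_append less_Suc_eq)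
      moreover have "binary_H s4" using * binary_H_cong[of s4 s1, OF H4] by simp
      ultimately have fin: "binary_H s4 \<and> (\<exists>r. ?P s4 r)"
        using * new rel_cong[of s4 s1, OF H4] H4 by (intro conjI exI[of _ "[v]"]) simp_all
      show "wp n (Seq (Write ''I'' (Var ''v'') (Const 1))
       (Seq (Write ''Q'' (Var ''t'') (Var ''v'')) (Assign ''t'' (Bin Add (Var ''t'') (Const 1)))))
       s1 (\<lambda>s'. binary_H s' \<and> (\<exists>r. ?P s' r))"
      proof (rule wp_Seq)
        show "wp n (Write ''I'' (Var ''v'') (Const 1)) s1 (\<lambda>s'. s' = s2)"
          using s1(1) two_le_n v frame by (intro wp_Write) (simp_all add: s2_def)
        fix s' assume "s' = s2"
        show "wp n (Seq (Write ''Q'' (Var ''t'') (Var ''v'')) (Assign ''t'' (Bin Add (Var ''t'') (Const 1)))) s'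
          (\<lambda>s'. binary_H s' \<and> (\<exists>r. ?P s' r))"
          unfolding \<open>s' = s2\<close>
        proof (rule wp_Seq)
          show "wp n (Write ''Q'' (Var ''t'') (Var ''v'')) s2 (\<lambda>s'. s' = s3)"
            using b2 two_le_n v frame t by (intro wp_Write) (simp_all add: s3_def s2_def)
          fix s' assume "s' = s3"
          have "s3 ''t'' 0 = length q" using frame t by (simp add: s3_def s2_def)
          then show "wp n (Assign ''t'' (Bin Add (Var ''t'') (Const 1))) s' (\<lambda>s'. binary_H s' \<and> (\<exists>r. ?P s' r))"
            unfolding \<open>s' = s3\<close> using b3 two_le_n len fin
            by (intro wp_Write) (simp_all add: s4_def[symmetric])
        qed
      qed
    qed
  next
    assume "val (Bin Mul (Entry ''H'' ''u'' ''v'')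
      (Bin Mul (Complement (Cell ''I'' ''v'')) (Complement (Cell ''D'' ''v'')))) s = 0"
    then have "rel s u v \<longrightarrow> v \<in> set q \<union> members ''D'' s" unfolding val by simp
    then have "binary_H s \<and> (\<exists>r. ?P s r)" using s q by (intro conjI exI[of _ "[]"]) simp_all
    then show "wp n Skip s (\<lambda>s'. binary_H s' \<and> (\<exists>r. ?P s' r))" by (intro wp_Skip s)
  qed simp
qed

text \<open>The guessed row may belong to no root. Therefore the queued rows are only claimed to be
  those of every root whose row at \<open>p\<close> agrees with the guess.\<close>

definition consistent :: "nat \<Rightarrow> (nat \<Rightarrow> bool) \<Rightarrow> nat set \<Rightarrow> nat list \<Rightarrow> (nat \<Rightarrow> nat \<Rightarrow> bool) \<Rightarrow> bool" where
  "consistent p row D q h \<longleftrightarrow> p \<in> set q \<and> set q \<inter> D = {} \<and>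
     (\<forall>h'. good {..<n} h' \<longrightarrow> (\<forall>v<n. row v = h' p v) \<longrightarrow> (\<forall>u\<in>set q. \<forall>v<n. h u v = h' u v))"

text \<open>Relative to a matching root the row of \<open>u\<close> is already right, so
  \<open>u\<close> and \<open>v\<close> are adjacent in that root and \<open>good_next_row\<close>
  forces the row of \<open>v\<close>.\<close>

lemma consistent_snoc:
  assumes c: "consistent p row D q h" and q: "set q \<subseteq> {..<n}" and u: "u \<in> set q"
    and v: "v < n" "h u v" "v \<notin> D"
    and old: "\<And>a b. a \<in> set q \<Longrightarrow> b < n \<Longrightarrow> h' a b = h a b"
    and new: "\<And>a. a < n \<Longrightarrow> h' v a = (a = u \<or> g u a \<and> g v a \<and> \<not> h u a)"
  shows "consistent p row D (q @ [v]) h'"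
  unfolding consistent_def
proof (intro conjI allI impI ballI)
  show "p \<in> set (q @ [v])" "set (q @ [v]) \<inter> D = {}" using c v by (auto simp: consistent_def)
  fix k a b assume k: "good {..<n} k" "\<forall>v<n. row v = k p v" and a: "a \<in> set (q @ [v])" and b: "b < n"
  then have eq: "h a b = k a b" if "a \<in> set q" "b < n" for a b
    using c that unfolding consistent_def by blast
  have un: "u < n" using u q by blast
  show "h' a b = k a b"
  proof (cases "a = v")
    case True
    have "k u v" using eq[OF u v(1)] v(2) by simp
    then show ?thesis
      using good_next_row[OF k(1) un v(1) b] new[OF b] eq[OF u b] True by simp
  next
    case False
    then show ?thesis using a old[of a b] eq[of a b] b by simp
  qed
qed

definition exploring :: "nat \<Rightarrow> state \<Rightarrow> nat list \<Rightarrow> state \<Rightarrow> bool" where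
  "exploring p s q s' \<longleftrightarrow> queue s' q \<and> binary_H s' \<and>
     consistent p (rel s p) (members ''D'' s) q (rel s') \<and>
     (\<forall>a\<in>members ''D'' s. \<forall>b<n. s' ''H'' (a * n + b) = s ''H'' (a * n + b))"

lemma exploring_cong:
  assumes "exploring p s q s1" "s2 ''t'' = s1 ''t''" "s2 ''Q'' = s1 ''Q''" "s2 ''I'' = s1 ''I''"
    "s2 ''H'' = s1 ''H''"
  shows "exploring p s q s2"
  using assms rel_cong[of s2 s1] binary_H_cong[of s2 s1] queue_cong[of s1 q s2]
  by (simp add: exploring_def)

lemma wp_visit_all:
  assumes s: "instance_in s1" "bounded n s1" "binary ''D'' s1" and D: "s1 ''D'' = s ''D''"
    and q: "exploring p s q s1" and u: "s1 ''u'' 0 = u" "u \<in> set q"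
  shows "wp n (For ''v'' visit) s1 (\<lambda>s'. \<exists>r. exploring p s (q @ r) s' \<and>
    (\<forall>a\<in>set q. \<forall>b<n. rel s' a b = rel s1 a b) \<and>
    (\<forall>v<n. rel s' u v \<longrightarrow> v \<in> set (q @ r) \<union> members ''D'' s))"
proof -
  let ?D = "members ''D'' s"
  \<comment> \<open>Row \<open>u\<close> is taken from \<open>s1\<close> throughout, since rows of
    queued vertices no longer change.\<close>
  let ?I = "\<lambda>k s'. \<exists>r. exploring p s (q @ r) s' \<and>
    (\<forall>a\<in>set q. \<forall>b<n. s' ''H'' (a * n + b) = s1 ''H'' (a * n + b)) \<and>
    (\<forall>v<k. rel s1 u v \<longrightarrow> v \<in> set (q @ r) \<union> ?D)"
  have un: "u < n" and qn: "set q \<subseteq> {..<n}" using q u by (auto simp: exploring_def queue_def)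
  show ?thesis
  proof (rule wp_For[OF two_le_n s(2) instance_inD(1)[OF s(1)], where I = ?I])
    show "?I 0 (s1(''v'' := (s1 ''v'')(0 := 0)))"
      using exploring_cong[OF q, of "s1(''v'' := (s1 ''v'')(0 := 0))"]
      by (intro exI[of _ "[]"]) simp
  next
    fix k s2
    assume k: "k < n" and "?I k s2" and b2: "bounded n s2" "s2 ''v'' 0 = k"
      and "\<And>x. x \<notin> insert ''v'' (writes visit) \<Longrightarrow> s2 x = s1 x"
    then obtain r where r: "exploring p s (q @ r) s2"
      and H2: "\<forall>a\<in>set q. \<forall>b<n. s2 ''H'' (a * n + b) = s1 ''H'' (a * n + b)"
      and vis: "\<forall>v<k. rel s1 u v \<longrightarrow> v \<in> set (q @ r) \<union> ?D"
      and frame: "s2 ''n'' = s1 ''n''" "s2 ''x'' = s1 ''x''" "s2 ''y'' = s1 ''y''" "s2 ''G'' = s1 ''G''"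
        "s2 ''D'' = s ''D''" "s2 ''u'' = s1 ''u''"
      using D by auto
    have inst: "instance_in s2" by (rule instance_in_cong[OF s(1)]) (fact frame)+
    have D2: "members ''D'' s2 = ?D" by (rule members_cong) (fact frame)
    have bD: "binary ''D'' s2" using s(3) binary_cong[of s2 "''D''" s1] frame D by simp
    have rel_u: "rel s2 u k = rel s1 u k" using H2 u(2) k by (simp add: rel_def)
    have qr: "queue s2 (q @ r)" "binary_H s2" "consistent p (rel s p) ?D (q @ r) (rel s2)"
      "\<forall>a\<in>?D. \<forall>b<n. s2 ''H'' (a * n + b) = s ''H'' (a * n + b)"
      using r by (simp_all add: exploring_def)
    have uqr: "u \<in> set (q @ r)" and qrn: "set (q @ r) \<subseteq> {..<n}"
      using u(2) qr(1) by (simp_all add: queue_def)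
    have su: "s2 ''u'' 0 = u" using u frame by simp
    show "wp n visit s2 (\<lambda>s3. ?I (Suc k) (s3(''v'' := (s3 ''v'')(0 := Suc k))))"
    proof (rule wp_mono[OF wp_visit[OF inst b2(1) qr(2) bD qr(1) su uqr b2(2) k]])
      fix s3
      assume "binary_H s3 \<and> (\<exists>r'. queue s3 ((q @ r) @ r') \<and>
        (\<forall>a b. a < n \<longrightarrow> b < n \<longrightarrow> a \<notin> set r' \<longrightarrow> s3 ''H'' (a * n + b) = s2 ''H'' (a * n + b)) \<and>
        (rel s2 u k \<longrightarrow> k \<in> set ((q @ r) @ r') \<union> members ''D'' s2) \<and>
        (r' = [] \<or> r' = [k] \<and> rel s2 u k \<and> k \<notin> members ''D'' s2 \<and>
          (\<forall>a<n. rel s3 k a = (a = u \<or> g u a \<and> g k a \<and> \<not> rel s2 u a))))"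
      then obtain r' where bH: "binary_H s3" and r': "queue s3 ((q @ r) @ r')"
        and H3: "\<And>a b. a < n \<Longrightarrow> b < n \<Longrightarrow> a \<notin> set r' \<Longrightarrow> s3 ''H'' (a * n + b) = s2 ''H'' (a * n + b)"
        and k': "rel s2 u k \<longrightarrow> k \<in> set ((q @ r) @ r') \<union> ?D"
        and cases: "r' = [] \<or> r' = [k] \<and> rel s2 u k \<and> k \<notin> ?D \<and>
          (\<forall>a<n. rel s3 k a = (a = u \<or> g u a \<and> g k a \<and> \<not> rel s2 u a))"
        unfolding D2 by blast
      have dist: "distinct ((q @ r) @ r')" using r' by (simp add: queue_def)
      have rel3: "rel s3 a b = rel s2 a b" if "a \<in> set (q @ r)" "b < n" for a b
      proof -
        have "a \<notin> set r'" "a < n" using that dist qrn by auto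
        then show ?thesis using H3[of a b] that by (simp add: rel_def)
      qed
      have "consistent p (rel s p) ?D ((q @ r) @ r') (rel s3)"
        using cases
      proof
        assume "r' = []"
        then show ?thesis using qr(3) rel3 by (simp add: consistent_def)
      next
        assume c: "r' = [k] \<and> rel s2 u k \<and> k \<notin> ?D \<and>
          (\<forall>a<n. rel s3 k a = (a = u \<or> g u a \<and> g k a \<and> \<not> rel s2 u a))"
        have "consistent p (rel s p) ?D ((q @ r) @ [k]) (rel s3)"
          by (rule consistent_snoc[OF qr(3) qrn uqr k]) (use c rel3 in simp_all)
        with c show ?thesis by simp
      qed
      moreover have "s3 ''H'' (a * n + b) = s ''H'' (a * n + b)" if "a \<in> ?D" "b < n" for a b
      proof -
        have "a \<notin> set r'" "a < n" using that cases by (auto simp: members_def)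
        then show ?thesis using H3[of a b] qr(4) that by simp
      qed
      ultimately have "exploring p s (q @ (r @ r')) s3"
        using r' bH by (simp add: exploring_def)
      then have "exploring p s (q @ (r @ r')) (s3(''v'' := (s3 ''v'')(0 := Suc k)))"
        by (rule exploring_cong) simp_all
      moreover have "s3 ''H'' (a * n + b) = s1 ''H'' (a * n + b)" if "a \<in> set q" "b < n" for a b
      proof -
        have "a \<notin> set r'" "a < n" using that dist qn by auto
        then show ?thesis using H3[of a b] H2 that by simp
      qed
      moreover have "\<forall>v<Suc k. rel s1 u v \<longrightarrow> v \<in> set (q @ r @ r') \<union> ?D"
        using vis k' rel_u by (auto simp: less_Suc_eq)
      ultimately show "?I (Suc k) (s3(''v'' := (s3 ''v'')(0 := Suc k)))"
        by (intro exI[of _ "r @ r'"]) simp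
    qed
  next
    fix s' assume "?I n s'"
    then show "\<exists>r. exploring p s (q @ r) s' \<and>
      (\<forall>a\<in>set q. \<forall>b<n. rel s' a b = rel s1 a b) \<and>
      (\<forall>v<n. rel s' u v \<longrightarrow> v \<in> set (q @ r) \<union> ?D)"
      using u(2) by (auto simp: rel_def)
  qed simp_all
qed

text \<open>If the guess is right, the queued rows are rows of the root \<open>h\<close>. No
  \<open>h\<close>-edge leads from \<open>q\<close> into the marked set, which is closed under
  \<open>g\<close>, so \<open>q\<close> is closed under \<open>h\<close> and \<open>h\<close> can be
  restricted to it.\<close>

lemma exploring_complete:
  assumes e: "exploring p s q s'"
    and all: "\<And>u v. u \<in> set q \<Longrightarrow> v < n \<Longrightarrow> rel s' u v \<Longrightarrow> v \<in> set q \<union> members ''D'' s"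
    and closed: "\<And>u v. u \<in> members ''D'' s \<Longrightarrow> g u v \<Longrightarrow> v \<in> members ''D'' s"
    and h: "good {..<n} h" "\<forall>v<n. rel s p v = h p v"
  shows "good (set q) (rel s')"
proof -
  have c: "set q \<inter> members ''D'' s = {}" "\<And>u v. u \<in> set q \<Longrightarrow> v < n \<Longrightarrow> rel s' u v = h u v"
    using e h by (auto simp: exploring_def consistent_def)
  have qn: "set q \<subseteq> {..<n}" using e by (simp add: exploring_def queue_def)
  have "good (set q) h"
  proof (rule good_restrict[OF h(1) qn])
    fix u v assume uv: "u \<in> set q" "v < n" "h u v"
    then have "g u v" using good_edge[OF h(1) _ uv(2)] qn by blast
    then have "v \<notin> members ''D'' s" using closed g_sym c(1) uv(1) by blast
    then show "v \<in> set q" using all[OF uv(1,2)] c(2)[OF uv(1,2)] uv(3) by simp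
  qed
  then show ?thesis by (rule good_cong) (simp add: c(2))
qed

lemma wp_propagate:
  assumes s: "instance_in s" "bounded n s" "binary_H s" "binary ''D'' s"
    and p: "queue s [p]" "p \<notin> members ''D'' s"
    and closed: "\<And>u v. u \<in> members ''D'' s \<Longrightarrow> g u v \<Longrightarrow> v \<in> members ''D'' s"
  shows "wp n propagate s (\<lambda>s'. binary_H s' \<and> binary ''I'' s' \<and> p \<in> members ''I'' s' \<and>
    members ''I'' s' \<inter> members ''D'' s = {} \<and>
    (\<forall>a\<in>members ''D'' s. \<forall>b<n. s' ''H'' (a * n + b) = s ''H'' (a * n + b)) \<and>
    (\<forall>h. good {..<n} h \<longrightarrow> (\<forall>v<n. rel s p v = h p v) \<longrightarrow> good (members ''I'' s') (rel s')))"
  unfolding propagate_def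
proof -
  let ?D = "members ''D'' s"
  let ?c = "If (Bin Less (Var ''j'') (Var ''t'')) (Seq (Assign ''u'' (Cell ''Q'' ''j'')) (For ''v'' visit)) Skip"
  let ?I = "\<lambda>j s'. \<exists>q. exploring p s q s' \<and>
    (\<forall>i<j. i < length q \<longrightarrow> (\<forall>v<n. rel s' (q ! i) v \<longrightarrow> v \<in> set q \<union> ?D))"
  have I_cong: "?I j s2" if "?I j s1" "s2 ''t'' = s1 ''t''" "s2 ''Q'' = s1 ''Q''" "s2 ''I'' = s1 ''I''"
    "s2 ''H'' = s1 ''H''" for j s1 s2
    using that exploring_cong[of p s _ s1 s2] rel_cong[of s2 s1] by metis
  show "wp n (For ''j'' ?c) s (\<lambda>s'. binary_H s' \<and> binary ''I'' s' \<and> p \<in> members ''I'' s' \<and>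
    members ''I'' s' \<inter> ?D = {} \<and> (\<forall>a\<in>?D. \<forall>b<n. s' ''H'' (a * n + b) = s ''H'' (a * n + b)) \<and>
    (\<forall>h. good {..<n} h \<longrightarrow> (\<forall>v<n. rel s p v = h p v) \<longrightarrow> good (members ''I'' s') (rel s')))"
  proof (rule wp_For[OF two_le_n s(2) instance_inD(1)[OF s(1)], where I = ?I])
    have "exploring p s [p] s" using p s(3) by (auto simp: exploring_def consistent_def)
    then have "?I 0 s" by blast
    then show "?I 0 (s(''j'' := (s ''j'')(0 := 0)))" by (rule I_cong) simp_all
  next
    fix j s1
    assume j: "j < n" and "?I j s1" and b1: "bounded n s1" "s1 ''j'' 0 = j"
      and "\<And>x. x \<notin> insert ''j'' (writes ?c) \<Longrightarrow> s1 x = s x"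
    then obtain q where q: "exploring p s q s1"
      and vis: "\<forall>i<j. i < length q \<longrightarrow> (\<forall>v<n. rel s1 (q ! i) v \<longrightarrow> v \<in> set q \<union> ?D)"
      and frame: "s1 ''n'' = s ''n''" "s1 ''x'' = s ''x''" "s1 ''y'' = s ''y''" "s1 ''G'' = s ''G''"
        "s1 ''D'' = s ''D''"
      by auto
    have queue: "queue s1 q" using q by (simp add: exploring_def)
    have inc: "?I (Suc j) (s'(''j'' := (s' ''j'')(0 := Suc j)))" if "?I (Suc j) s'" for s'
      by (rule I_cong[OF that]) simp_all
    show "wp n ?c s1 (\<lambda>s'. ?I (Suc j) (s'(''j'' := (s' ''j'')(0 := Suc j))))"
    proof (rule wp_If[OF two_le_n b1(1)])
      assume "val (Bin Less (Var ''j'') (Var ''t'')) s1 \<noteq> 0"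
      then have jq: "j < length q" using b1 queue by (auto simp: queue_def split: if_splits)
      define s2 where "s2 = s1(''u'' := (s1 ''u'')(0 := q ! j))"
      have Qj: "s1 ''Q'' j = q ! j" using queue jq by (simp add: queue_def)
      show "wp n (Seq (Assign ''u'' (Cell ''Q'' ''j'')) (For ''v'' visit)) s1
        (\<lambda>s'. ?I (Suc j) (s'(''j'' := (s' ''j'')(0 := Suc j))))"
      proof (rule wp_Seq)
        show "wp n (Assign ''u'' (Cell ''Q'' ''j'')) s1 (\<lambda>s'. s' = s2)"
          using b1 two_le_n boundedD[OF b1(1), of "''Q''" j] Qj
          by (intro wp_Write) (simp_all add: s2_def)
        fix s' assume "bounded n s'" "s' = s2"
        then have b2: "bounded n s2" by simp
        have inst: "instance_in s2" by (rule instance_in_cong[OF s(1)]) (simp_all add: s2_def frame)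
        have bD: "binary ''D'' s2" using s(4) binary_cong[of s2 "''D''" s] frame by (simp add: s2_def)
        have q2: "exploring p s q s2" by (rule exploring_cong[OF q]) (simp_all add: s2_def)
        have u2: "s2 ''u'' 0 = q ! j" "q ! j \<in> set q" using jq by (simp_all add: s2_def)
        have D2: "s2 ''D'' = s ''D''" by (simp add: s2_def frame)
        have rel2: "rel s2 = rel s1" by (rule rel_cong) (simp add: s2_def)
        show "wp n (For ''v'' visit) s' (\<lambda>s'. ?I (Suc j) (s'(''j'' := (s' ''j'')(0 := Suc j))))"
          unfolding \<open>s' = s2\<close>
        proof (rule wp_mono[OF wp_visit_all[OF inst b2 bD D2 q2 u2]], rule inc)
          fix s3
          assume "\<exists>r. exploring p s (q @ r) s3 \<and>
            (\<forall>a\<in>set q. \<forall>b<n. rel s3 a b = rel s2 a b) \<and>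
            (\<forall>v<n. rel s3 (q ! j) v \<longrightarrow> v \<in> set (q @ r) \<union> ?D)"
          then obtain r where r: "exploring p s (q @ r) s3"
            and old: "\<forall>a\<in>set q. \<forall>b<n. rel s3 a b = rel s1 a b"
            and new: "\<forall>v<n. rel s3 (q ! j) v \<longrightarrow> v \<in> set (q @ r) \<union> ?D"
            unfolding rel2 by blast
          \<comment> \<open>Entries before position \<open>j\<close> keep their rows, and the queue
            only grows.\<close>
          have "v \<in> set (q @ r) \<union> ?D"
            if i: "i < Suc j" "i < length (q @ r)" "v < n" "rel s3 ((q @ r) ! i) v" for i v
          proof (cases "i = j")
            case True
            then show ?thesis using new i jq by (simp add: nth_append)
          next
            case False
            then have "i < j" using i by simp
            then have "rel s1 (q ! i) v" "i < length q" using old i jq by (simp_all add: nth_append)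
            then show ?thesis using vis \<open>i < j\<close> i(3) by auto
          qed
          with r show "?I (Suc j) s3" by blast
        qed
      qed
    next
      assume "val (Bin Less (Var ''j'') (Var ''t'')) s1 = 0"
      then have "length q \<le> j" using b1 queue by (auto simp: queue_def split: if_splits)
      with q vis have "?I (Suc j) s1" by (intro exI[of _ q]) (simp add: less_Suc_eq)
      then show "wp n Skip s1 (\<lambda>s'. ?I (Suc j) (s'(''j'' := (s' ''j'')(0 := Suc j))))"
        by (intro wp_Skip b1 inc)
    qed simp
  next
    fix s' assume "?I n s'"
    then obtain q where q: "exploring p s q s'"
      and vis: "\<forall>i<n. i < length q \<longrightarrow> (\<forall>v<n. rel s' (q ! i) v \<longrightarrow> v \<in> set q \<union> ?D)" by blast
    have queue: "queue s' q" "binary_H s'"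
      "\<forall>a\<in>?D. \<forall>b<n. s' ''H'' (a * n + b) = s ''H'' (a * n + b)" "p \<in> set q" "set q \<inter> ?D = {}"
      using q by (simp_all add: exploring_def consistent_def)
    have I: "members ''I'' s' = set q" "binary ''I'' s'"
      using queue(1) by (auto simp: queue_def members_def binary_def of_bool_def split: if_splits)
    have "length q \<le> n" using queue(1) queue_length by (simp add: queue_def)
    then have all: "v \<in> set q \<union> ?D" if "u \<in> set q" "v < n" "rel s' u v" for u v
      using that vis by (metis in_set_conv_nth less_le_trans)
    have "good (set q) (rel s')" if "good {..<n} h" "\<forall>v<n. rel s p v = h p v" for h
      by (rule exploring_complete[OF q]) (fact all closed that)+
    then show "binary_H s' \<and> binary ''I'' s' \<and> p \<in> members ''I'' s' \<and>
      members ''I'' s' \<inter> ?D = {} \<and> (\<forall>a\<in>?D. \<forall>b<n. s' ''H'' (a * n + b) = s ''H'' (a * n + b)) \<and>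
      (\<forall>h. good {..<n} h \<longrightarrow> (\<forall>v<n. rel s p v = h p v) \<longrightarrow> good (members ''I'' s') (rel s'))"
      unfolding I(1) using I(2) queue by blast
  qed simp_all
qed

section \<open>The check and the marking of verified rows\<close>

definition good_pair :: "nat set \<Rightarrow> (nat \<Rightarrow> nat \<Rightarrow> bool) \<Rightarrow> nat \<Rightarrow> nat \<Rightarrow> bool" where
  "good_pair K h u v \<longleftrightarrow>
     (h u v \<longrightarrow> v \<in> K \<and> h v u \<and> u \<noteq> v) \<and>
     (u \<noteq> v \<longrightarrow> of_bool (g u v) = of_bool (h u v) + card (between h u v)) \<and>
     (h u v \<longrightarrow> (\<forall>w<n. g u w \<longrightarrow> g v w \<longrightarrow> h u w \<or> h v w)) \<and>
     (u = x \<and> v = y \<longrightarrow> h u v)"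

lemma good_iff_good_pair: "good K h \<longleftrightarrow> (\<forall>u\<in>K. \<forall>v<n. good_pair K h u v)"
  by (simp add: good_def good_pair_def)

lemma wp_check_triple:
  assumes s: "instance_in s" "bounded n s" "binary_H s"
    and u: "s ''u'' 0 = u" "u < n" and v: "s ''v'' 0 = v" "v < n" and a: "s ''a'' 0 = a" "a < n"
    and c: "s ''c'' 0 = c" "c + of_bool (rel s u a \<and> rel s a v) \<le> n" and k: "s ''k'' 0 = of_bool b"
  shows "wp n check_triple s (\<lambda>s'. s' ''c'' 0 = c + of_bool (rel s u a \<and> rel s a v) \<and>
    s' ''k'' 0 = of_bool (b \<and> (rel s u v \<longrightarrow> g u a \<longrightarrow> g v a \<longrightarrow> rel s u a \<or> rel s v a)))"
  unfolding check_triple_def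
proof (rule wp_Seq)
  note G = instance_inD(1)[OF s(1)] instance_inD(4)[OF s(1)] and H = H_of_bool[OF s(3)]
  let ?s = "s(''c'' := (s ''c'')(0 := c + of_bool (rel s u a \<and> rel s a v)))"
  have "val (Bin Add (Var ''c'') (Bin Mul (Entry ''H'' ''u'' ''a'') (Entry ''H'' ''a'' ''v''))) s =
    c + of_bool (rel s u a \<and> rel s a v)"
    using u v a c G(1) H[OF u(2) a(2)] H[OF a(2) v(2)] by simp
  then show "wp n (Assign ''c'' (Bin Add (Var ''c'') (Bin Mul (Entry ''H'' ''u'' ''a'') (Entry ''H'' ''a'' ''v'')))) s
    (\<lambda>s'. s' = ?s)"
    using s c two_le_n by (intro wp_Write) simp_all
  fix s' :: state assume b': "bounded n s'" and s': "s' = ?s"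
  have *: "val (Bin Mul (Var ''k'') triple_condition) s' =
     of_bool (b \<and> (rel s u v \<longrightarrow> g u a \<longrightarrow> g v a \<longrightarrow> rel s u a \<or> rel s v a))"
    using u v a k G(1) G(2)[OF u(2) a(2)] G(2)[OF v(2) a(2)] H[OF u(2) a(2)] H[OF v(2) a(2)]
      H[OF u(2) v(2)]
    by (simp add: s' triple_condition_def)
  show "wp n (Assign ''k'' (Bin Mul (Var ''k'') triple_condition)) s'
    (\<lambda>s'. s' ''c'' 0 = c + of_bool (rel s u a \<and> rel s a v) \<and>
    s' ''k'' 0 = of_bool (b \<and> (rel s u v \<longrightarrow> g u a \<longrightarrow> g v a \<longrightarrow> rel s u a \<or> rel s v a)))"
  proof (rule wp_Write[OF two_le_n b'], goal_cases)
    case 3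
    show ?case unfolding * using two_le_n by simp
  next
    case 4
    show ?case unfolding * by (simp add: s')
  qed (simp_all add: triple_condition_def)
qed

lemma wp_check_pair:
  assumes s: "instance_in s" "bounded n s" "binary_H s" "binary ''I'' s"
    and u: "s ''u'' 0 = u" "u < n" and v: "s ''v'' 0 = v" "v < n" and k: "s ''k'' 0 = of_bool b"
  shows "wp n check_pair s (\<lambda>s'. s' ''k'' 0 = of_bool (b \<and> good_pair (members ''I'' s) (rel s) u v))"
  unfolding check_pair_def
proof (rule wp_Seq)
  let ?s = "s(''c'' := (s ''c'')(0 := 0))"
  let ?P = "\<lambda>w. rel s u v \<longrightarrow> g u w \<longrightarrow> g v w \<longrightarrow> rel s u w \<or> rel s v w"
  let ?I = "\<lambda>a (s' :: state). s' ''c'' 0 = card {z. z < a \<and> rel s u z \<and> rel s z v} \<and>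
    s' ''k'' 0 = of_bool (b \<and> (\<forall>w<a. ?P w))"
  show "wp n (Assign ''c'' (Const 0)) s (\<lambda>s'. s' = ?s)"
    using s two_le_n by (intro wp_Write) simp_all
  fix s1 assume b1: "bounded n s1" and s1: "s1 = ?s"
  have frame1: "s1 x = s x" if "x \<noteq> ''c''" for x using that s1 by simp
  show "wp n (Seq (For ''a'' check_triple) (Assign ''k'' (Bin Mul (Var ''k'') pair_condition))) s1
     (\<lambda>s'. s' ''k'' 0 = of_bool (b \<and> good_pair (members ''I'' s) (rel s) u v))"
  proof (rule wp_Seq)
    show "wp n (For ''a'' check_triple) s1 (?I n)"
    proof (rule wp_For[OF two_le_n b1, where I = ?I])
      show "s1 ''n'' 0 = n" using instance_inD(1)[OF s(1)] frame1 by simp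
      show "?I 0 (s1(''a'' := (s1 ''a'')(0 := 0)))" using k s1 by simp
      fix a s2 assume a: "a < n" and I: "?I a s2" and b2: "bounded n s2" "s2 ''a'' 0 = a"
        and "\<And>x. x \<notin> insert ''a'' (writes check_triple) \<Longrightarrow> s2 x = s1 x"
      then have frame: "s2 x = s x" if "x \<notin> {''a'', ''c'', ''k''}" for x using that frame1 by simp
      have inst: "instance_in s2" by (rule instance_in_cong[OF s(1)]) (simp_all add: frame)
      have H: "binary_H s2" using binary_H_cong[of s2 s] frame s(3) by simp
      have R: "rel s2 = rel s" by (rule rel_cong) (simp add: frame)
      \<comment> \<open>Counting over \<open>Suc a\<close> candidates keeps \<open>c\<close> at most
        \<open>n\<close> also after the coming increment.\<close>
      have "card {z. z < Suc a \<and> rel s u z \<and> rel s z v} \<le> n"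
        using card_less_Collect_le[of "Suc a"] a by (meson Suc_leI le_trans)
      then have card_le: "card {z. z < a \<and> rel s u z \<and> rel s z v} + of_bool (rel s2 u a \<and> rel s2 a v) \<le> n"
        unfolding R card_less_Suc_Collect .
      have uv2: "s2 ''u'' 0 = u" "s2 ''v'' 0 = v" using u v by (simp_all add: frame)
      note triple = wp_check_triple[OF inst b2(1) H uv2(1) u(2) uv2(2) v(2) b2(2) a I[THEN conjunct1]
          card_le I[THEN conjunct2]]
      show "wp n check_triple s2 (\<lambda>s''. ?I (Suc a) (s''(''a'' := (s'' ''a'')(0 := Suc a))))"
        by (rule wp_mono[OF triple]) (simp add: R card_less_Suc_Collect All_less_Suc conj_ac)
    qed simp_all
  next
    fix s2 assume b2: "bounded n s2" and "\<And>x. x \<notin> writes (For ''a'' check_triple) \<Longrightarrow> s2 x = s1 x"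
      and I: "?I n s2"
    then have frame: "s2 x = s x" if "x \<notin> {''a'', ''c'', ''k''}" for x using that frame1 by simp
    have same: "s2 ''u'' = s ''u''" "s2 ''v'' = s ''v''" "s2 ''n'' = s ''n''" "s2 ''x'' = s ''x''"
      "s2 ''y'' = s ''y''" "s2 ''H'' = s ''H''" "s2 ''G'' = s ''G''" "s2 ''I'' = s ''I''"
      by (rule frame, simp)+
    have reads: "s2 ''u'' 0 = u" "s2 ''v'' 0 = v" "s2 ''n'' 0 = n" "s2 ''x'' 0 = x" "s2 ''y'' 0 = y"
      "s2 ''H'' (u * n + v) = of_bool (rel s u v)" "s2 ''H'' (v * n + u) = of_bool (rel s v u)"
      "s2 ''G'' (u * n + v) = of_bool (g u v)" "s2 ''I'' v = of_bool (v \<in> members ''I'' s)"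
      "s2 ''c'' 0 = card (between (rel s) u v)" "s2 ''k'' 0 = of_bool (b \<and> (\<forall>w<n. ?P w))"
      unfolding same between_def
      by (fact u v instance_inD(1-3)[OF s(1)] instance_inD(4)[OF s(1) u(2) v(2)] I[THEN conjunct1]
        I[THEN conjunct2] H_of_bool[OF s(3) u(2) v(2)] H_of_bool[OF s(3) v(2) u(2)]
        cell_of_bool[OF s(4) v(2)])+
    have *: "val (Bin Mul (Var ''k'') pair_condition) s2 =
      of_bool (b \<and> good_pair (members ''I'' s) (rel s) u v)"
      unfolding pair_condition_def val.simps binop_val.simps reads check_value good_pair_def
      by (rule arg_cong[where f = of_bool]) blast
    show "wp n (Assign ''k'' (Bin Mul (Var ''k'') pair_condition)) s2
     (\<lambda>s'. s' ''k'' 0 = of_bool (b \<and> good_pair (members ''I'' s) (rel s) u v))"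
    proof (rule wp_Write[OF two_le_n b2], goal_cases)
      case 3
      show ?case unfolding * using two_le_n by simp
    next
      case 4
      show ?case unfolding * by simp
    qed (simp_all add: pair_condition_def)
  qed
qed

lemma wp_check:
  assumes s: "instance_in s" "bounded n s" "binary_H s" "binary ''I'' s"
  shows "wp n check s (\<lambda>s'. s' ''k'' 0 = of_bool (good (members ''I'' s) (rel s)))"
  unfolding check_def
proof (rule wp_Seq)
  let ?K = "members ''I'' s"
  let ?I = "\<lambda>u (s' :: state). s' ''k'' 0 = of_bool (\<forall>u'<u. u' \<in> ?K \<longrightarrow> (\<forall>v<n. good_pair ?K (rel s) u' v))"
  show "wp n (Assign ''k'' (Const 1)) s (\<lambda>s'. s' = s(''k'' := (s ''k'')(0 := 1)))"
    using s two_le_n by (intro wp_Write) simp_all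
  fix s1 assume b1: "bounded n s1" and s1: "s1 = s(''k'' := (s ''k'')(0 := 1))"
  let ?c = "If (Cell ''I'' ''u'') (For ''v'' check_pair) Skip"
  show "wp n (For ''u'' ?c) s1 (\<lambda>s'. s' ''k'' 0 = of_bool (good ?K (rel s)))"
  proof (rule wp_For[OF two_le_n b1, where I = ?I])
    show "s1 ''n'' 0 = n" using instance_inD(1)[OF s(1)] s1 by simp
    show "?I 0 (s1(''u'' := (s1 ''u'')(0 := 0)))" using s1 by simp
    fix u s2 assume u: "u < n" and I: "?I u s2" and b2: "bounded n s2" "s2 ''u'' 0 = u"
      and "\<And>x. x \<notin> insert ''u'' (writes ?c) \<Longrightarrow> s2 x = s1 x"
    then have frame: "s2 x = s x" if "x \<notin> {''u'', ''v'', ''a'', ''c'', ''k''}" for x using that s1 by simp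
    have Iu: "s2 ''I'' u = of_bool (u \<in> ?K)" using cell_of_bool[OF s(4) u] frame by simp
    show "wp n ?c s2 (\<lambda>s''. ?I (Suc u) (s''(''u'' := (s'' ''u'')(0 := Suc u))))"
    proof (rule wp_If[OF two_le_n b2(1)])
      assume "val (Cell ''I'' ''u'') s2 \<noteq> 0"
      then have uK: "u \<in> ?K" using Iu b2 by (simp split: if_splits)
      \<comment> \<open>The flag \<open>k\<close> is shared by all rows, so the inner invariant has
        to carry the verdict on the earlier ones.\<close>
      let ?b = "\<forall>u'<u. u' \<in> ?K \<longrightarrow> (\<forall>v<n. good_pair ?K (rel s) u' v)"
      let ?J = "\<lambda>v (s' :: state). s' ''k'' 0 = of_bool (?b \<and> (\<forall>v'<v. good_pair ?K (rel s) u v'))"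
      show "wp n (For ''v'' check_pair) s2 (\<lambda>s''. ?I (Suc u) (s''(''u'' := (s'' ''u'')(0 := Suc u))))"
      proof (rule wp_For[OF two_le_n b2(1), where I = ?J])
        show "s2 ''n'' 0 = n" using instance_inD(1)[OF s(1)] frame by simp
        show "?J 0 (s2(''v'' := (s2 ''v'')(0 := 0)))" using I by simp
        fix v s3 assume v: "v < n" and J: "?J v s3" and b3: "bounded n s3" "s3 ''v'' 0 = v"
          and fr: "\<And>x. x \<notin> insert ''v'' (writes check_pair) \<Longrightarrow> s3 x = s2 x"
        then have frame3: "s3 x = s x" if "x \<notin> {''u'', ''v'', ''a'', ''c'', ''k''}" for x
          using that frame by simp
        have inst: "instance_in s3" by (rule instance_in_cong[OF s(1)]) (simp_all add: frame3)
        have H: "binary_H s3" using binary_H_cong[of s3 s] frame3 s(3) by simp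
        have R: "rel s3 = rel s" by (rule rel_cong) (simp add: frame3)
        have B: "binary ''I'' s3" using binary_cong[of s3 "''I''" s] frame3 s(4) by simp
        have M: "members ''I'' s3 = ?K" by (rule members_cong) (simp add: frame3)
        have u3: "s3 ''u'' 0 = u" using fr[of "''u''"] b2 by simp
        from wp_check_pair[OF inst b3(1) H B u3 u b3(2) v J]
        show "wp n check_pair s3 (\<lambda>s''. ?J (Suc v) (s''(''v'' := (s'' ''v'')(0 := Suc v))))"
          unfolding M R by (rule wp_mono) (simp add: All_less_Suc conj_ac)
      next
        fix s' :: state assume "?J n s'"
        then show "?I (Suc u) (s'(''u'' := (s' ''u'')(0 := Suc u)))"
          using uK by (simp add: All_less_Suc conj_ac)
      qed simp_all
    next
      assume "val (Cell ''I'' ''u'') s2 = 0"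
      then have uK: "u \<notin> ?K" using Iu b2 by (simp split: if_splits)
      then have "?I (Suc u) (s2(''u'' := (s2 ''u'')(0 := Suc u)))" using I by (simp add: All_less_Suc)
      then show "wp n Skip s2 (\<lambda>s''. ?I (Suc u) (s''(''u'' := (s'' ''u'')(0 := Suc u))))"
        by (intro wp_Skip b2)
    qed simp
  next
    fix s' :: state assume "?I n s'"
    moreover have "(\<forall>u'<n. u' \<in> ?K \<longrightarrow> (\<forall>v<n. good_pair ?K (rel s) u' v)) \<longleftrightarrow> good ?K (rel s)"
      unfolding good_iff_good_pair by (auto simp: members_def)
    ultimately show "s' ''k'' 0 = of_bool (good ?K (rel s))" by simp
  qed simp_all
qed

lemma wp_commit:
  assumes s: "bounded n s" "s ''n'' 0 = n" "binary ''I'' s" "binary ''D'' s" and k: "s ''k'' 0 = of_bool b"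
  shows "wp n commit s (\<lambda>s'. binary ''D'' s' \<and>
    members ''D'' s' = members ''D'' s \<union> (if b then members ''I'' s else {}))"
  unfolding commit_def
proof (rule wp_For[OF two_le_n s(1,2), where I = "\<lambda>k s'.
    \<forall>v<n. s' ''D'' v = of_bool (v \<in> members ''D'' s \<or> (v < k \<and> b \<and> v \<in> members ''I'' s))"])
  let ?c = "Write ''D'' (Var ''v'') (Bin Less (Const 0) (Bin Add (Cell ''D'' ''v'') (Bin Mul (Var ''k'') (Cell ''I'' ''v''))))"
  let ?I = "\<lambda>k (s' :: state). \<forall>v<n. s' ''D'' v = of_bool (v \<in> members ''D'' s \<or> (v < k \<and> b \<and> v \<in> members ''I'' s))"
  show "?I 0 (s(''v'' := (s ''v'')(0 := 0)))" using cell_of_bool[OF s(4)] by simp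
  fix v s' assume v: "v < n" and I: "?I v s'" and b': "bounded n s'" "s' ''v'' 0 = v"
    and "\<And>x. x \<notin> insert ''v'' (writes ?c) \<Longrightarrow> s' x = s x"
  then have frame: "s' x = s x" if "x \<notin> {''v'', ''D''}" for x using that by simp
  have val: "val (Bin Less (Const 0) (Bin Add (Cell ''D'' ''v'') (Bin Mul (Var ''k'') (Cell ''I'' ''v'')))) s' =
    of_bool (v \<in> members ''D'' s \<or> b \<and> v \<in> members ''I'' s)"
    using I v b' k cell_of_bool[OF s(3) v] by (simp add: frame)
  show "wp n ?c s' (\<lambda>s''. ?I (Suc v) (s''(''v'' := (s'' ''v'')(0 := Suc v))))"
  proof (rule wp_Write[OF two_le_n b'(1)], goal_cases)
    case 3
    show ?case unfolding val using two_le_n by simp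
  next
    case 4
    show ?case unfolding val using I b' by (auto simp: less_Suc_eq)
  qed simp_all
next
  fix s' :: state assume I: "\<forall>v<n. s' ''D'' v = of_bool (v \<in> members ''D'' s \<or> (v < n \<and> b \<and> v \<in> members ''I'' s))"
  then have "s' ''D'' v = 1 \<longleftrightarrow> v \<in> members ''D'' s \<or> (b \<and> v \<in> members ''I'' s)" if "v < n" for v
    using that by (simp add: of_bool_def)
  then have "members ''D'' s' = members ''D'' s \<union> (if b then members ''I'' s else {})"
    unfolding members_def[of _ s'] by (auto simp: members_def)
  with I show "binary ''D'' s' \<and> members ''D'' s' = members ''D'' s \<union> (if b then members ''I'' s else {})"
    by (simp add: binary_def)
qed simp_all

lemma wp_start:
  assumes s: "bounded n s" "s ''p'' 0 = p" "p < n" and I: "\<forall>v<n. s ''I'' v = 0"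
  shows "wp n start s (\<lambda>s'. queue s' [p])"
  unfolding start_def
proof (rule wp_Seq)
  let ?s1 = "s(''I'' := (s ''I'')(p := 1))"
  let ?s2 = "?s1(''Q'' := (s ''Q'')(0 := p))"
  show "wp n (Write ''I'' (Var ''p'') (Const 1)) s (\<lambda>s'. s' = ?s1)"
    using s two_le_n by (intro wp_Write) simp_all
  fix s1 assume s1: "bounded n s1" "s1 = ?s1"
  show "wp n (Seq (Write ''Q'' (Const 0) (Var ''p'')) (Assign ''t'' (Const 1))) s1 (\<lambda>s'. queue s' [p])"
  proof (rule wp_Seq)
    show "wp n (Write ''Q'' (Const 0) (Var ''p'')) s1 (\<lambda>s'. s' = ?s2)"
      using s s1 two_le_n by (intro wp_Write) simp_all
    fix s2 assume "bounded n s2" "s2 = ?s2"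
    then show "wp n (Assign ''t'' (Const 1)) s2 (\<lambda>s'. queue s' [p])"
      using s(3) I two_le_n by (intro wp_Write) (simp_all add: queue_def)
  qed
qed

section \<open>A single attempt\<close>

definition sound :: "state \<Rightarrow> bool" where
  "sound s \<longleftrightarrow> instance_in s \<and> binary_H s \<and> binary ''D'' s \<and> good (members ''D'' s) (rel s)"

lemma sound_cong:
  assumes "sound s" "s' ''n'' = s ''n''" "s' ''x'' = s ''x''" "s' ''y'' = s ''y''" "s' ''G'' = s ''G''"
    "s' ''H'' = s ''H''" "s' ''D'' = s ''D''"
  shows "sound s'"
  using assms instance_in_cong[of s s'] rel_cong[of s' s] members_cong[of s' "''D''" s]
    binary_cong[of s' "''D''" s] binary_H_cong[of s' s]
  by (simp add: sound_def)

text \<open>Soundness never relies on the guess, since vertices are marked only after a positive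
  check, and a failed attempt has changed only rows of \<open>H\<close> outside \<open>D\<close>. A
  correct guess makes the check succeed by the last conjunct of \<open>wp_propagate\<close>.\<close>

lemma wp_attempt:
  assumes s: "sound s" "bounded n s"
    and p: "s ''p'' 0 = p" "p < n" "p \<notin> members ''D'' s"
    and w: "s ''w'' 0 = w" "w < n" and z: "s ''z'' 0 = z" "z < n" and b: "s ''o'' 0 = of_bool b"
  shows "wp n attempt s (\<lambda>s'. sound s' \<and> members ''D'' s \<subseteq> members ''D'' s' \<and>
    (\<forall>h. good {..<n} h \<longrightarrow> (\<forall>v<n. root_row p w z b v = h p v) \<longrightarrow> p \<in> members ''D'' s'))"
    (is "wp n attempt s ?Q")
  unfolding attempt_def
proof (rule wp_Seq)
  let ?D = "members ''D'' s"
  have inst: "instance_in s" and goodD: "good ?D (rel s)" and bH: "binary_H s" and bD: "binary ''D'' s"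
    using s(1) by (simp_all add: sound_def)
  show "wp n clear s (\<lambda>s'. \<forall>v<n. s' ''I'' v = 0)" by (rule wp_clear[OF s(2) instance_inD(1)[OF inst]])
  fix s1 assume b1: "bounded n s1" and f1: "\<And>x. x \<notin> writes clear \<Longrightarrow> s1 x = s x"
    and I1: "\<forall>v<n. s1 ''I'' v = 0"
  have i1: "instance_in s1" by (rule instance_in_cong[OF inst]) (simp_all add: f1)
  have bH1: "binary_H s1" using binary_H_cong[of s1 s] f1 bH by simp
  have v1: "s1 ''p'' 0 = p" "s1 ''w'' 0 = w" "s1 ''z'' 0 = z" "s1 ''o'' 0 = of_bool b"
    using p w z b f1 by simp_all
  show "wp n (Seq first_row (Seq start (Seq propagate (Seq check commit)))) s1 ?Q"
  proof (rule wp_Seq[OF wp_first_row[OF i1 b1 bH1 v1(1) p(2) v1(2) w(2) v1(3) z(2) v1(4)]])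
    fix s2 assume b2: "bounded n s2" and f2: "\<And>x. x \<notin> writes first_row \<Longrightarrow> s2 x = s1 x"
      and "binary_H s2 \<and> (\<forall>v<n. rel s2 p v = root_row p w z b v) \<and>
        (\<forall>u v. u < n \<longrightarrow> v < n \<longrightarrow> u \<noteq> p \<longrightarrow> s2 ''H'' (u * n + v) = s1 ''H'' (u * n + v))"
    then have bH2: "binary_H s2" and row: "\<forall>v<n. rel s2 p v = root_row p w z b v"
      and H2: "\<And>u v. u < n \<Longrightarrow> v < n \<Longrightarrow> u \<noteq> p \<Longrightarrow> s2 ''H'' (u * n + v) = s ''H'' (u * n + v)"
      using f1 by simp_all
    have "s2 ''p'' 0 = p" "\<forall>v<n. s2 ''I'' v = 0" using v1 I1 f2 by simp_all
    note start = wp_start[OF b2 this(1) p(2) this(2)]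
    show "wp n (Seq start (Seq propagate (Seq check commit))) s2 ?Q"
    proof (rule wp_Seq[OF start])
      fix s3 assume b3: "bounded n s3" and f3: "\<And>x. x \<notin> writes start \<Longrightarrow> s3 x = s2 x"
        and q: "queue s3 [p]"
      have frame3: "s3 x = s x" if "x \<notin> {''v'', ''I'', ''H'', ''Q'', ''t''}" for x
        using that f1 f2 f3 by simp
      have i3: "instance_in s3" by (rule instance_in_cong[OF inst]) (simp_all add: frame3)
      have bH3: "binary_H s3" using binary_H_cong[of s3 s2] f3 bH2 by simp
      have bD3: "binary ''D'' s3" using binary_cong[of s3 "''D''" s] frame3 bD by simp
      have D3: "members ''D'' s3 = ?D" by (rule members_cong) (simp add: frame3)
      have rel3: "rel s3 = rel s2" by (rule rel_cong) (simp add: f3)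
      \<comment> \<open>Marked vertices form a union of components, as the propagation
        requires.\<close>
      have "v \<in> members ''D'' s3" if "u \<in> members ''D'' s3" "g u v" for u v
        using good_closed[OF goodD _ that(2)] that(1) unfolding D3 .
      note propagate = wp_propagate[OF i3 b3 bH3 bD3 q p(3)[folded D3] this]
      show "wp n (Seq propagate (Seq check commit)) s3 ?Q"
      proof (rule wp_Seq[OF propagate])
        fix s4 assume b4: "bounded n s4" and f4: "\<And>x. x \<notin> writes propagate \<Longrightarrow> s4 x = s3 x"
        let ?K = "members ''I'' s4"
        assume "binary_H s4 \<and> binary ''I'' s4 \<and> p \<in> ?K \<and> ?K \<inter> members ''D'' s3 = {} \<and>
          (\<forall>a\<in>members ''D'' s3. \<forall>b<n. s4 ''H'' (a * n + b) = s3 ''H'' (a * n + b)) \<and>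
          (\<forall>h. good {..<n} h \<longrightarrow> (\<forall>v<n. rel s3 p v = h p v) \<longrightarrow> good ?K (rel s4))"
        then have bH4: "binary_H s4" and bI4: "binary ''I'' s4" and pK: "p \<in> ?K"
          and H4: "\<forall>a\<in>?D. \<forall>b<n. s4 ''H'' (a * n + b) = s3 ''H'' (a * n + b)"
          and complete: "\<forall>h. good {..<n} h \<longrightarrow> (\<forall>v<n. rel s3 p v = h p v) \<longrightarrow> good ?K (rel s4)"
          unfolding D3 by blast+
        have frame4: "s4 x = s x" if "x \<notin> {''v'', ''I'', ''H'', ''Q'', ''t'', ''j'', ''u'', ''a''}" for x
          using that frame3 f4 by simp
        have i4: "instance_in s4" by (rule instance_in_cong[OF inst]) (simp_all add: frame4)
        have relD: "rel s u v = rel s4 u v" if "u \<in> ?D" "v < n" for u v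
        proof -
          have "u \<noteq> p" "u < n" using that p by (auto simp: members_def)
          then show ?thesis using that H4 H2[of u v] f3[of "''H''"] by (simp add: rel_def)
        qed
        have goodD4: "good ?D (rel s4)" by (rule good_cong[OF goodD relD])
        show "wp n (Seq check commit) s4 ?Q"
        proof (rule wp_Seq[OF wp_check[OF i4 b4 bH4 bI4]])
          fix s5 assume b5: "bounded n s5" and f5: "\<And>x. x \<notin> writes check \<Longrightarrow> s5 x = s4 x"
            and k: "s5 ''k'' 0 = of_bool (good ?K (rel s4))"
          have frame5: "s5 x = s x"
            if "x \<notin> {''v'', ''I'', ''H'', ''Q'', ''t'', ''j'', ''u'', ''a'', ''c'', ''k''}" for x
            using that frame4 f5 by simp
          have n5: "s5 ''n'' 0 = n" using instance_inD(1)[OF inst] frame5 by simp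
          have bI5: "binary ''I'' s5" using binary_cong[of s5 "''I''" s4] f5 bI4 by simp
          have bD5: "binary ''D'' s5" using binary_cong[of s5 "''D''" s] frame5 bD by simp
          have D5: "members ''D'' s5 = ?D" by (rule members_cong) (simp add: frame5)
          have I5: "members ''I'' s5 = ?K" by (rule members_cong) (simp add: f5)
          show "wp n commit s5 ?Q"
          proof (rule wp_mono[OF wp_commit[OF b5 n5 bI5 bD5 k]])
            fix s6 assume f6: "\<And>x. x \<notin> writes commit \<Longrightarrow> s6 x = s5 x"
              and D6: "binary ''D'' s6 \<and> members ''D'' s6 = members ''D'' s5 \<union>
                (if good ?K (rel s4) then members ''I'' s5 else {})"
            have frame6: "s6 x = s x"
              if "x \<notin> {''v'', ''I'', ''H'', ''Q'', ''t'', ''j'', ''u'', ''a'', ''c'', ''k'', ''D''}" for x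
              using that frame5 f6 by simp
            have i6: "instance_in s6" by (rule instance_in_cong[OF inst]) (simp_all add: frame6)
            have H6: "s6 ''H'' = s4 ''H''" using f5 f6 by simp
            have "good (members ''D'' s6) (rel s4)"
              using D6 goodD4 good_Un[OF goodD4, of ?K] unfolding D5 I5 by (simp split: if_splits)
            then have "sound s6"
              using i6 D6 bH4 rel_cong[of s6 s4, OF H6] binary_H_cong[of s6 s4, OF H6]
              by (simp add: sound_def)
            moreover have "good ?K (rel s4)" if "good {..<n} h" "\<forall>v<n. root_row p w z b v = h p v" for h
              using complete that row unfolding rel3 by simp
            ultimately show "?Q s6" using D6 pK unfolding D5 I5 by auto
          qed
        qed
      qed
    qed
  qed
qed

lemma wp_attempt_if:
  assumes s: "sound s" "bounded n s" and p: "s ''p'' 0 = p" "p < n"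
    and w: "s ''w'' 0 = w" "w < n" and z: "s ''z'' 0 = z" "z < n"
  shows "wp n (attempt_if (of_bool b)) s (\<lambda>s'. sound s' \<and> members ''D'' s \<subseteq> members ''D'' s' \<and>
    (\<forall>h. good {..<n} h \<longrightarrow> (\<forall>v<n. root_row p w z b v = h p v) \<longrightarrow> p \<in> members ''D'' s'))"
    (is "wp n _ s ?Q")
  unfolding attempt_if_def
proof (rule wp_If[OF two_le_n s(2)])
  have D: "s ''D'' p = of_bool (p \<in> members ''D'' s)"
    using s(1) p(2) by (intro cell_of_bool) (simp_all add: sound_def)
  show "wp n Skip s ?Q" if "val (Cell ''D'' ''p'') s \<noteq> 0"
    using that s p D by (intro wp_Skip) (auto split: if_splits)
  assume "val (Cell ''D'' ''p'') s = 0"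
  then have pD: "p \<notin> members ''D'' s" using p D by (auto split: if_splits)
  let ?s1 = "s(''o'' := (s ''o'')(0 := of_bool b))"
  show "wp n (Seq (Assign ''o'' (Const (of_bool b))) attempt) s ?Q"
  proof (rule wp_Seq)
    show "wp n (Assign ''o'' (Const (of_bool b))) s (\<lambda>s'. s' = ?s1)"
      using s two_le_n by (intro wp_Write) (simp_all)
    fix s1 assume b1: "bounded n s1" and s1: "s1 = ?s1"
    have sound: "sound s1" by (rule sound_cong[OF s(1)]) (simp_all add: s1)
    have D1: "members ''D'' s1 = members ''D'' s" by (rule members_cong) (simp add: s1)
    have v1: "s1 ''p'' 0 = p" "s1 ''w'' 0 = w" "s1 ''z'' 0 = z" "s1 ''o'' 0 = of_bool b"
      using p w z by (simp_all add: s1)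
    show "wp n attempt s1 ?Q"
      using wp_attempt[OF sound b1 v1(1) p(2) pD[folded D1] v1(2) w(2) v1(3) z(2) v1(4)]
      unfolding D1 .
  qed
qed simp

section \<open>Search over pairs and its completeness\<close>

definition least_neighbour :: "nat \<Rightarrow> nat" where
  "least_neighbour w = (LEAST v. v = w \<or> g w v)"

lemma wp_find_least:
  assumes s: "instance_in s" "bounded n s" and w: "s ''w'' 0 = w" "w < n"
  shows "wp n find_least s (\<lambda>s'. s' ''p'' 0 = least_neighbour w)"
  unfolding find_least_def
proof (rule wp_Seq)
  let ?I = "\<lambda>k (s' :: state). (s' ''p'' 0 = w \<or> g w (s' ''p'' 0)) \<and> s' ''p'' 0 \<le> w \<and>
    (\<forall>v<k. g w v \<longrightarrow> s' ''p'' 0 \<le> v)"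
  let ?c = "If (Bin Mul (Entry ''G'' ''w'' ''v'') (Bin Less (Var ''v'') (Var ''p''))) (Assign ''p'' (Var ''v'')) Skip"
  show "wp n (Assign ''p'' (Var ''w'')) s (\<lambda>s'. s' = s(''p'' := (s ''p'')(0 := w)))"
    using s w two_le_n by (intro wp_Write) simp_all
  fix s1 assume b1: "bounded n s1" and s1: "s1 = s(''p'' := (s ''p'')(0 := w))"
  have n1: "s1 ''n'' 0 = n" using instance_inD(1)[OF s(1)] by (simp add: s1)
  show "wp n (For ''v'' ?c) s1 (\<lambda>s'. s' ''p'' 0 = least_neighbour w)"
  proof (rule wp_For[OF two_le_n b1 n1, where I = ?I])
    show "?I 0 (s1(''v'' := (s1 ''v'')(0 := 0)))" by (simp add: s1)
    fix v s2 assume v: "v < n" and I: "?I v s2"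
      and b2: "bounded n s2" "s2 ''v'' 0 = v"
      and "\<And>x. x \<notin> insert ''v'' (writes ?c) \<Longrightarrow> s2 x = s1 x"
    then have frame: "s2 x = s x" if "x \<notin> {''v'', ''p''}" for x using that s1 by simp
    have val: "val (Bin Mul (Entry ''G'' ''w'' ''v'') (Bin Less (Var ''v'') (Var ''p''))) s2
      = of_bool (g w v \<and> v < s2 ''p'' 0)"
      using b2 w instance_inD(1)[OF s(1)] instance_inD(4)[OF s(1) w(2) v] by (simp add: frame)
    show "wp n ?c s2 (\<lambda>s''. ?I (Suc v) (s''(''v'' := (s'' ''v'')(0 := Suc v))))"
    proof (rule wp_If[OF two_le_n b2(1)], unfold val)
      assume "of_bool (g w v \<and> v < s2 ''p'' 0) \<noteq> (0::nat)"
      then show "wp n (Assign ''p'' (Var ''v'')) s2 (\<lambda>s''. ?I (Suc v) (s''(''v'' := (s'' ''v'')(0 := Suc v))))"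
        using I v b2 two_le_n by (intro wp_Write) (auto simp: less_Suc_eq)
    next
      assume "of_bool (g w v \<and> v < s2 ''p'' 0) = (0::nat)"
      then show "wp n Skip s2 (\<lambda>s''. ?I (Suc v) (s''(''v'' := (s'' ''v'')(0 := Suc v))))"
        using I b2 by (intro wp_Skip) (auto simp: less_Suc_eq)
    qed simp
  next
    fix s' :: state
    assume "?I n s'"
    then show "s' ''p'' 0 = least_neighbour w"
      unfolding least_neighbour_def using g_bounded'[of w] by (intro Least_equality[symmetric]) auto
  qed simp_all
qed

lemma wp_find_common:
  assumes s: "instance_in s" "bounded n s" and w: "s ''w'' 0 = w" "w < n" and p: "s ''p'' 0 = p" "p < n"
  shows "wp n find_common s (\<lambda>s'. s' ''z'' 0 < n \<and>
    (g p (s' ''z'' 0) \<and> g w (s' ''z'' 0) \<or> (\<forall>a. \<not> (g p a \<and> g w a))))"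
  unfolding find_common_def
proof (rule wp_Seq)
  let ?c = "If (Bin Mul (Entry ''G'' ''p'' ''v'') (Entry ''G'' ''w'' ''v'')) (Assign ''z'' (Var ''v'')) Skip"
  let ?P = "\<lambda>(s' :: state) k. s' ''z'' 0 < n \<and> (g p (s' ''z'' 0) \<and> g w (s' ''z'' 0) \<or> (\<forall>a<k. \<not> (g p a \<and> g w a)))"
  \<comment> \<open>The default 0 is a vertex because \<open>n\<close> is positive; it remains when
    there is no common neighbour, where any \<open>z\<close> serves.\<close>
  show "wp n (Assign ''z'' (Const 0)) s (\<lambda>s'. s' = s(''z'' := (s ''z'')(0 := 0)))"
    using s two_le_n by (intro wp_Write) simp_all
  fix s1 assume b1: "bounded n s1" and s1: "s1 = s(''z'' := (s ''z'')(0 := 0))"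
  have n1: "s1 ''n'' 0 = n" using instance_inD(1)[OF s(1)] by (simp add: s1)
  show "wp n (For ''v'' ?c) s1 (\<lambda>s'. s' ''z'' 0 < n \<and>
    (g p (s' ''z'' 0) \<and> g w (s' ''z'' 0) \<or> (\<forall>a. \<not> (g p a \<and> g w a))))"
  proof (rule wp_For[OF two_le_n b1 n1, where I = "\<lambda>k s'. ?P s' k"])
    show "?P (s1(''v'' := (s1 ''v'')(0 := 0))) 0" using two_le_n by (simp add: s1)
    fix v s2 assume v: "v < n" and I: "?P s2 v" and b2: "bounded n s2" "s2 ''v'' 0 = v"
      and "\<And>x. x \<notin> insert ''v'' (writes ?c) \<Longrightarrow> s2 x = s1 x"
    then have frame: "s2 x = s x" if "x \<notin> {''v'', ''z''}" for x using that s1 by simp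
    have val: "val (Bin Mul (Entry ''G'' ''p'' ''v'') (Entry ''G'' ''w'' ''v'')) s2 = of_bool (g p v \<and> g w v)"
      using b2 w p instance_inD(1)[OF s(1)] instance_inD(4)[OF s(1) w(2) v] instance_inD(4)[OF s(1) p(2) v]
      by (simp add: frame)
    show "wp n ?c s2 (\<lambda>s''. ?P (s''(''v'' := (s'' ''v'')(0 := Suc v))) (Suc v))"
    proof (rule wp_If[OF two_le_n b2(1)], unfold val)
      assume "of_bool (g p v \<and> g w v) \<noteq> (0::nat)"
      then show "wp n (Assign ''z'' (Var ''v'')) s2 (\<lambda>s''. ?P (s''(''v'' := (s'' ''v'')(0 := Suc v))) (Suc v))"
        using v b2 two_le_n by (intro wp_Write) auto
    next
      assume "of_bool (g p v \<and> g w v) = (0::nat)"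
      then show "wp n Skip s2 (\<lambda>s''. ?P (s''(''v'' := (s'' ''v'')(0 := Suc v))) (Suc v))"
        using I b2 by (intro wp_Skip) (auto simp: less_Suc_eq)
    qed simp
  next
    fix s' :: state assume "?P s' n"
    then show "s' ''z'' 0 < n \<and> (g p (s' ''z'' 0) \<and> g w (s' ''z'' 0) \<or> (\<forall>a. \<not> (g p a \<and> g w a)))"
      using g_bounded'[of p] by blast
  qed simp_all
qed

text \<open>The last part of \<open>root_row_exists\<close>: whichever \<open>z\<close> is returned
  by \<open>find_common\<close>, one of the two attempts at the pair starts from the right row of
  \<open>h\<close>.\<close>

definition rooted_at :: "nat \<Rightarrow> nat \<Rightarrow> (nat \<Rightarrow> nat \<Rightarrow> bool) \<Rightarrow> bool" where
  "rooted_at p w h \<longleftrightarrow> (\<forall>z. g p z \<and> g w z \<or> (\<forall>a. \<not> (g p a \<and> g w a)) \<longrightarrow>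
     (\<exists>b. \<forall>v<n. root_row p w z b v = h p v))"

lemma wp_search:
  assumes s: "sound s" "bounded n s"
  shows "wp n search s (\<lambda>s'. sound s' \<and> (\<forall>w<n. \<forall>h. good {..<n} h \<longrightarrow>
    rooted_at (least_neighbour w) w h \<longrightarrow> least_neighbour w \<in> members ''D'' s'))"
  unfolding search_def
proof -
  let ?c = "Seq find_least (Seq find_common (Seq (attempt_if 0) (attempt_if 1)))"
  let ?I = "\<lambda>k s'. sound s' \<and> (\<forall>w<k. \<forall>h. good {..<n} h \<longrightarrow>
    rooted_at (least_neighbour w) w h \<longrightarrow> least_neighbour w \<in> members ''D'' s')"
  have n: "s ''n'' 0 = n" using s(1) by (simp add: sound_def instance_inD)
  show "wp n (For ''w'' ?c) s (?I n)"
  proof (rule wp_For[OF two_le_n s(2) n, where I = ?I])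
    have "sound (s(''w'' := (s ''w'')(0 := 0)))" by (rule sound_cong[OF s(1)]) simp_all
    then show "?I 0 (s(''w'' := (s ''w'')(0 := 0)))" by simp
  next
    fix w s1 assume w: "w < n" and I: "?I w s1" and b1: "bounded n s1" and w1: "s1 ''w'' 0 = w"
    define p where "p = least_neighbour w"
    have "p \<le> w" unfolding p_def least_neighbour_def by (rule Least_le) simp
    then have p: "p < n" using w by simp
    have S1: "sound s1" and i1: "instance_in s1" using I by (simp_all add: sound_def)
    show "wp n ?c s1 (\<lambda>s''. ?I (Suc w) (s''(''w'' := (s'' ''w'')(0 := Suc w))))"
    proof (rule wp_Seq[OF wp_find_least[OF i1 b1 w1 w]])
      fix s2 assume b2: "bounded n s2" and f2: "\<And>x. x \<notin> writes find_least \<Longrightarrow> s2 x = s1 x"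
        and p2: "s2 ''p'' 0 = least_neighbour w"
      have S2: "sound s2" by (rule sound_cong[OF S1]) (simp_all add: f2)
      then have i2: "instance_in s2" by (simp add: sound_def)
      have w2: "s2 ''w'' 0 = w" using f2 w1 by simp
      show "wp n (Seq find_common (Seq (attempt_if 0) (attempt_if 1))) s2
        (\<lambda>s''. ?I (Suc w) (s''(''w'' := (s'' ''w'')(0 := Suc w))))"
      proof (rule wp_Seq[OF wp_find_common[OF i2 b2 w2 w p2[folded p_def] p]])
        fix s3 assume b3: "bounded n s3" and f3: "\<And>x. x \<notin> writes find_common \<Longrightarrow> s3 x = s2 x"
        define z where "z = s3 ''z'' 0"
        assume "s3 ''z'' 0 < n \<and> (g p (s3 ''z'' 0) \<and> g w (s3 ''z'' 0) \<or> (\<forall>a. \<not> (g p a \<and> g w a)))"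
        then have z: "z < n" "g p z \<and> g w z \<or> (\<forall>a. \<not> (g p a \<and> g w a))" by (simp_all add: z_def)
        have S3: "sound s3" by (rule sound_cong[OF S2]) (simp_all add: f3)
        have v3: "s3 ''p'' 0 = p" "s3 ''w'' 0 = w" "s3 ''z'' 0 = z"
          using f3 p2 w2 by (simp_all add: z_def p_def)
        have D3: "members ''D'' s3 = members ''D'' s1" by (rule members_cong) (simp add: f3 f2)
        show "wp n (Seq (attempt_if 0) (attempt_if 1)) s3
          (\<lambda>s''. ?I (Suc w) (s''(''w'' := (s'' ''w'')(0 := Suc w))))"
        proof (rule wp_Seq[OF wp_attempt_if[OF S3 b3 v3(1) p v3(2) w v3(3) z(1), of False, unfolded of_bool_eq]])
          fix s4 assume b4: "bounded n s4" and f4: "\<And>x. x \<notin> writes (attempt_if 0) \<Longrightarrow> s4 x = s3 x"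
            and "sound s4 \<and> members ''D'' s3 \<subseteq> members ''D'' s4 \<and>
              (\<forall>h. good {..<n} h \<longrightarrow> (\<forall>v<n. root_row p w z False v = h p v) \<longrightarrow> p \<in> members ''D'' s4)"
          then have S4: "sound s4" and D4: "members ''D'' s1 \<subseteq> members ''D'' s4"
            and F: "\<forall>h. good {..<n} h \<longrightarrow> (\<forall>v<n. root_row p w z False v = h p v) \<longrightarrow> p \<in> members ''D'' s4"
            unfolding D3 by blast+
          have v4: "s4 ''p'' 0 = p" "s4 ''w'' 0 = w" "s4 ''z'' 0 = z" using f4 v3 by simp_all
          show "wp n (attempt_if 1) s4 (\<lambda>s''. ?I (Suc w) (s''(''w'' := (s'' ''w'')(0 := Suc w))))"
          proof (rule wp_mono[OF wp_attempt_if[OF S4 b4 v4(1) p v4(2) w v4(3) z(1), of True, unfolded of_bool_eq]])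
            fix s5
            assume "sound s5 \<and> members ''D'' s4 \<subseteq> members ''D'' s5 \<and>
              (\<forall>h. good {..<n} h \<longrightarrow> (\<forall>v<n. root_row p w z True v = h p v) \<longrightarrow> p \<in> members ''D'' s5)"
            then have S5: "sound s5" and D5: "members ''D'' s4 \<subseteq> members ''D'' s5"
              and T: "\<forall>h. good {..<n} h \<longrightarrow> (\<forall>v<n. root_row p w z True v = h p v) \<longrightarrow> p \<in> members ''D'' s5"
              by blast+
            let ?s6 = "s5(''w'' := (s5 ''w'')(0 := Suc w))"
            have D6: "members ''D'' ?s6 = members ''D'' s5" by (rule members_cong) simp
            have "sound ?s6" by (rule sound_cong[OF S5]) simp_all
            \<comment> \<open>The root decides which of the two guesses is right; a mark set by the
              first attempt survives the second.\<close>
            moreover have "p \<in> members ''D'' s5" if h: "good {..<n} h" "rooted_at p w h" for h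
            proof -
              obtain b where b: "\<forall>v<n. root_row p w z b v = h p v"
                using h(2)[unfolded rooted_at_def, THEN spec, THEN mp, OF z(2)] by (elim exE)
              show ?thesis
              proof (cases b)
                case True
                with b T[THEN spec, THEN mp, OF h(1)] show ?thesis by simp
              next
                case False
                with b F[THEN spec, THEN mp, OF h(1)] have "p \<in> members ''D'' s4" by simp
                then show ?thesis using D5 by (rule subsetD[rotated])
              qed
            qed
            moreover have "least_neighbour w' \<in> members ''D'' s5"
              if "w' < w" "good {..<n} h" "rooted_at (least_neighbour w') w' h" for w' h
            proof -
              have "least_neighbour w' \<in> members ''D'' s1"
                using I[THEN conjunct2, THEN spec, THEN mp, OF that(1), THEN spec, THEN mp, OF that(2)] that(3)
                by (rule mp)
              then show ?thesis using D4 D5 by (meson subsetD)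
            qed
            ultimately show "?I (Suc w) ?s6" unfolding D6 All_less_Suc p_def by simp
          qed
        qed
      qed
    qed
  qed simp_all
qed

text \<open>Let \<open>p\<close> be the least unmarked vertex and \<open>w\<close> its partner from
  \<open>root_row_exists\<close>. Marks are closed under \<open>g\<close>, so \<open>w\<close> and
  all its neighbours are unmarked and \<open>p\<close> is the least of them. The pair was therefore
  tried, which marks \<open>p\<close>.\<close>

lemma search_complete:
  assumes s: "sound s" and complete: "\<And>w h. w < n \<Longrightarrow> good {..<n} h \<Longrightarrow>
      rooted_at (least_neighbour w) w h \<Longrightarrow> least_neighbour w \<in> members ''D'' s"
    and h: "good {..<n} h"
  shows "members ''D'' s = {..<n}"
proof (rule ccontr)
  let ?D = "members ''D'' s"
  assume "?D \<noteq> {..<n}"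
  then obtain v where "v < n \<and> v \<notin> ?D" by (auto simp: members_def)
  define p where "p = (LEAST v. v < n \<and> v \<notin> ?D)"
  have p: "p < n" "p \<notin> ?D" and least: "\<And>v. v < n \<Longrightarrow> v \<notin> ?D \<Longrightarrow> p \<le> v"
    using LeastI[of "\<lambda>v. v < n \<and> v \<notin> ?D"] Least_le[of "\<lambda>v. v < n \<and> v \<notin> ?D"] \<open>v < n \<and> v \<notin> ?D\<close>
    unfolding p_def by blast+
  obtain w where w: "w < n" "w = p \<or> g w p" "rooted_at p w h"
    using root_row_exists[OF h p(1)] unfolding rooted_at_def by blast
  have closed: "v \<in> ?D" if "u \<in> ?D" "g u v" for u v
    using s good_closed that unfolding sound_def by blast
  have "w \<notin> ?D" using w(2) closed p(2) by blast
  then have "v \<notin> ?D" if "g w v" for v using closed g_sym[OF that] by blast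
  then have "p \<le> v" if "v = w \<or> g w v" for v
    using that least[of v] w(1) \<open>w \<notin> ?D\<close> g_bounded'[of w v] by blast
  then have "least_neighbour w = p"
    unfolding least_neighbour_def using w(2) by (intro Least_equality) auto
  then show False using complete[OF w(1) h] w(3) p(2) by simp
qed

section \<open>The answer and the whole program\<close>

lemma wp_decide:
  assumes s: "sound s" "bounded n s"
  shows "wp n decide s (\<lambda>s'. s' ''answer'' 0 = of_bool (members ''D'' s = {..<n}))"
  unfolding decide_def
proof (rule wp_Seq)
  let ?I = "\<lambda>k (s' :: state). s' ''answer'' 0 = of_bool (\<forall>v<k. v \<in> members ''D'' s)"
  let ?c = "Assign ''answer'' (Bin Mul (Var ''answer'') (Cell ''D'' ''v''))"
  have n: "s ''n'' 0 = n" and D: "binary ''D'' s" using s(1) by (simp_all add: sound_def instance_inD)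
  show "wp n (Assign ''answer'' (Const 1)) s (\<lambda>s'. s' = s(''answer'' := (s ''answer'')(0 := 1)))"
    using s two_le_n by (intro wp_Write) simp_all
  fix s1 assume b1: "bounded n s1" and s1: "s1 = s(''answer'' := (s ''answer'')(0 := 1))"
  have n1: "s1 ''n'' 0 = n" using n by (simp add: s1)
  show "wp n (For ''v'' ?c) s1 (\<lambda>s'. s' ''answer'' 0 = of_bool (members ''D'' s = {..<n}))"
  proof (rule wp_For[OF two_le_n b1 n1, where I = ?I])
    fix v s2 assume v: "v < n" and I: "?I v s2" and b2: "bounded n s2" "s2 ''v'' 0 = v"
      and "\<And>x. x \<notin> insert ''v'' (writes ?c) \<Longrightarrow> s2 x = s1 x"
    then have "s2 ''D'' v = of_bool (v \<in> members ''D'' s)" using cell_of_bool[OF D v] s1 by simp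
    then show "wp n ?c s2 (\<lambda>s''. ?I (Suc v) (s''(''v'' := (s'' ''v'')(0 := Suc v))))"
      using I b2 two_le_n by (intro wp_Write) (auto simp: All_less_Suc)
  next
    fix s' :: state assume "?I n s'"
    moreover have "(\<forall>v<n. v \<in> members ''D'' s) \<longleftrightarrow> members ''D'' s = {..<n}" by (auto simp: members_def)
    ultimately show "s' ''answer'' 0 = of_bool (members ''D'' s = {..<n})" by simp
  qed (simp_all add: s1)
qed

text \<open>If every vertex is marked, soundness is goodness on the whole vertex set; if some good
  relation exists, \<open>search_complete\<close> shows that every vertex is marked.\<close>

lemma wp_root_program:
  assumes s: "sound s" "bounded n s"
  shows "wp n root_program s (\<lambda>s'. binary_H s' \<and>
    (if \<exists>h. good {..<n} h then s' ''answer'' 0 = 1 \<and> good {..<n} (rel s') else s' ''answer'' 0 = 0))"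
  unfolding root_program_def
proof (rule wp_Seq[OF wp_search[OF s]])
  fix s1 assume b1: "bounded n s1" and s1: "sound s1 \<and> (\<forall>w<n. \<forall>h. good {..<n} h \<longrightarrow>
    rooted_at (least_neighbour w) w h \<longrightarrow> least_neighbour w \<in> members ''D'' s1)"
  then have S: "sound s1" by blast
  show "wp n decide s1 (\<lambda>s'. binary_H s' \<and>
    (if \<exists>h. good {..<n} h then s' ''answer'' 0 = 1 \<and> good {..<n} (rel s') else s' ''answer'' 0 = 0))"
  proof (rule wp_mono[OF wp_decide[OF S b1]])
    fix s2 assume f: "\<And>x. x \<notin> writes decide \<Longrightarrow> s2 x = s1 x"
      and a: "s2 ''answer'' 0 = of_bool (members ''D'' s1 = {..<n})"
    have H: "s2 ''H'' = s1 ''H''" using f by (simp add: decide_def)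
    have "members ''D'' s1 = {..<n}" if "good {..<n} h" for h
      by (rule search_complete[OF S _ that]) (use s1 in blast)
    moreover have "good {..<n} (rel s2)" if "members ''D'' s1 = {..<n}"
      using S that rel_cong[of s2 s1, OF H] by (simp add: sound_def)
    ultimately show "binary_H s2 \<and>
      (if \<exists>h. good {..<n} h then s2 ''answer'' 0 = 1 \<and> good {..<n} (rel s2) else s2 ''answer'' 0 = 0)"
      using a S binary_H_cong[of s2 s1, OF H] by (auto simp: sound_def)
  qed
qed

end

theorem theorem3p4:
  "\<exists>(P :: com) (d :: nat) (T :: nat \<Rightarrow> nat).
     (\<lambda>n. real (T n)) \<in> O(\<lambda>n. real n ^ 4) \<and>
     (\<forall>(n :: nat) (G :: nat ugraph) (x :: nat) (y :: nat).
        simple_graph G \<and> verts G = {..<n} \<and> {x, y} \<in> edges G \<longrightarrow>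
        (\<exists>t s. exec (n ^ d) P (input n G x y) t s \<and> t \<le> T n \<and>
           (if \<exists>H. root_with_edge G x y H
            then answer s = 1 \<and> (\<exists>H. root_with_edge G x y H \<and> outputs s n H)
            else answer s = 0)))"
proof (rule exI[of _ root_program], rule exI[of _ 20], rule exI[of _ "\<lambda>n. time_bound n root_program"],
    intro conjI allI impI)
  \<comment> \<open>The exponent is the loop depth of the program.\<close>
  obtain C where C: "\<forall>n\<ge>1. time_bound n root_program \<le> C * n ^ 4"
    using time_bound_le_power[of root_program] unfolding loop_depth_root_program by blast
  show "(\<lambda>n. real (time_bound n root_program)) \<in> O(\<lambda>n. real n ^ 4)"
  proof (rule bigoI[of _ "real C"])
    show "\<forall>\<^sub>F n in sequentially. norm (real (time_bound n root_program)) \<le> real C * norm (real n ^ 4)"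
      using eventually_ge_at_top[of 1]
    proof eventually_elim
      case (elim n)
      then have "real (time_bound n root_program) \<le> real (C * n ^ 4)" using C of_nat_le_iff by blast
      then show ?case by simp
    qed
  qed
next
  fix n x y and G :: "nat ugraph"
  assume "simple_graph G \<and> verts G = {..<n} \<and> {x, y} \<in> edges G"
  then have G: "simple_graph G" "verts G = {..<n}" "{x, y} \<in> edges G" by blast+
  define g where "g = (\<lambda>u v. {u, v} \<in> edges G)"
  have edge: "u < n" "v < n" "u \<noteq> v" if "g u v" for u v
  proof -
    have "{u, v} \<subseteq> {..<n}" "card {u, v} = 2"
      using G(1)[unfolded simple_graph_def, THEN conjunct2, THEN bspec, OF that[unfolded g_def]]
      unfolding G(2) by blast+
    then show "u < n" "v < n" "u \<noteq> v" by auto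
  qed
  interpret square_instance n x y g
  proof
    show "g x y" using G by (simp add: g_def)
    show "g v u" if "g u v" for u v using that unfolding g_def by (metis insert_commute)
    \<comment> \<open>The prescribed edge supplies two distinct vertices, so tiny \<open>n\<close>
      needs no separate treatment.\<close>
    from edge[OF \<open>g x y\<close>] show "2 \<le> n" by linarith
  qed (use edge in blast)+
  let ?s = "input n G x y"
  have xy: "x < n" "y < n" using edge[OF g_xy] by blast+
  have "bounded n ?s" using two_le_n xy by (simp add: bounded_def input_def adj_def)
  moreover have "sound ?s"
  proof -
    have G_cell: "?s ''G'' (u * n + v) = of_bool (g u v)" if "u < n" "v < n" for u v
    proof -
      have "u * n + v < Suc u * n" using that by simp
      also have "\<dots> \<le> n * n" using that by (intro mult_le_mono1) simp
      finally show ?thesis using that by (simp add: input_def adj_def g_def)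
    qed
    have "instance_in ?s"
      unfolding instance_in_def by (intro conjI allI impI G_cell) (simp_all add: input_def)
    moreover have "members ''D'' ?s = {}" "binary ''D'' ?s" "binary_H ?s"
      by (simp_all add: members_def binary_def binary_H_def input_def)
    \<comment> \<open>Nothing is marked at the start, so goodness of the marked set is
      vacuous.\<close>
    ultimately show ?thesis by (simp add: sound_def good_def)
  qed
  ultimately obtain t s where exec: "exec (n ^ 20) root_program ?s t s" "t \<le> time_bound n root_program"
    and bH: "binary_H s"
    and res: "if \<exists>h. good {..<n} h then s ''answer'' 0 = 1 \<and> good {..<n} (rel s) else s ''answer'' 0 = 0"
    using wp_root_program unfolding wp_def by blast
  have g: "\<And>u v. g u v \<longleftrightarrow> {u, v} \<in> edges G" by (simp add: g_def)
  \<comment> \<open>Passing to unordered pairs loses nothing when \<open>rel s\<close> is good,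
    hence symmetric; the matrix in memory is then the adjacency matrix of \<open>?H\<close>.\<close>
  let ?H = "\<lparr>verts = {..<n}, edges = {{u, v} |u v. u < n \<and> v < n \<and> rel s u v}\<rparr>"
  have out: "root_with_edge G x y ?H \<and> outputs s n ?H" if good: "good {..<n} (rel s)"
  proof
    note root = good_imp_root_with_edge[OF G(1,2) g good refl]
    show "root_with_edge G x y ?H" by (rule root(1))
    show "outputs s n ?H"
      unfolding outputs_def
    proof (intro conjI allI impI)
      fix u v assume uv: "u < n" "v < n"
      show "s ''H'' (u * n + v) = adj ?H u v"
        unfolding adj_def root(2)[OF uv] H_of_bool[OF bH uv] by (rule of_bool_def)
    qed simp
  qed
  have "if \<exists>H. root_with_edge G x y H
     then answer s = 1 \<and> (\<exists>H. root_with_edge G x y H \<and> outputs s n H) else answer s = 0"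
  proof (cases "\<exists>h. good {..<n} h")
    case True
    then have *: "s ''answer'' 0 = 1" and "root_with_edge G x y ?H \<and> outputs s n ?H"
      using res out by simp_all
    then have ex: "\<exists>H. root_with_edge G x y H \<and> outputs s n H" by (intro exI)
    then have P: "\<exists>H. root_with_edge G x y H" by blast
    show ?thesis unfolding answer_def if_P[OF P] using * ex by (rule conjI)
  next
    case False
    then have N: "\<nexists>H. root_with_edge G x y H" using root_with_edge_imp_good[OF G(2) g] by metis
    show ?thesis unfolding answer_def if_not_P[OF N] using res unfolding if_not_P[OF False] .
  qed
  with exec show "\<exists>t s. exec (n ^ 20) root_program ?s t s \<and> t \<le> time_bound n root_program \<and>
    (if \<exists>H. root_with_edge G x y H
     then answer s = 1 \<and> (\<exists>H. root_with_edge G x y H \<and> outputs s n H) else answer s = 0)"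
    by (intro exI conjI)
qed

end
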